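(* Let $I$ be an arbitrary instance of a Max-2CSP problem (or of a Binary Function Optimization Problem, BFOP) with $n$ variables and $m$ constraints (respectively functions), whose weights are drawn independently from distributions supported on $[-1,1]$ with density at most $\phi$. Then with probability at least $1-o_n(1)$ over the draw of the weights, every implementation of the FLIP algorithm running on $I$ (for every initial assignment and every pivoting rule) takes at most $\phi\, m\, n^{O(\sqrt{\log n})}$ steps to terminate.
   Context: A Max-2CSP instance consists of Boolean variables $x_1,\dots,x_n$ (domain $\{0,1\}$) and constraints $c_1,\dots,c_m$ with weights $w_1,\dots,w_m$, where each constraint $c_i$ is a relation $R_i\subseteq\{0,1\}^{r_i}$ with $r_i\le 2$ applied to a tuple of variables; the objective of an assignment is the total weight of satisfied constraints. A BFOP instance consists of Boolean variables $x_1,\dots,x_n$ and functions $f_1,\dots,f_m$, each $f_i$ a function of a pair of variables with values in $\{0,1,\dots,k\}$ for a fixed $k$, with weights $w_1,\dots,w_m$; the objective of an assignment $\tau$ is $\sum_i w_i f_i(\tau(t_i))$ where $t_i$ is the pair of variables of $f_i$. The FLIP algorithm starts from some assignment and repeatedly flips the value of a single variable whose flip strictly increases the objective (chosen by an arbitrary pivoting rule) until no such variable exists. *)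

theory Defs
  imports "HOL-Probability.Probability" "HOL-Library.Landau_Symbols"
begin

text \<open>
  The variables of an instance on \<open>n\<close> variables are the numbers \<open>i < n\<close>. Assignments are total
  functions; values at arguments \<open>i \<ge> n\<close> never occur in the objective and are never flipped.
\<close>

type_synonym assignment = "nat \<Rightarrow> bool"

text \<open>
  A constraint is a scope (a tuple of variables, repetitions allowed) with a relation on the
  truth values of the scope. Weights are kept separate from the instance because they are random.
\<close>

type_synonym csp_constraint = "nat list \<times> bool list set"

definition max2csp_instance :: "nat \<Rightarrow> csp_constraint list \<Rightarrow> bool" where
  "max2csp_instance n cs \<longleftrightarrow>
     (\<forall>(t, R) \<in> set cs. length t \<le> 2 \<and> set t \<subseteq> {..<n} \<and> R \<subseteq> {v. length v = length t})"

definition satisfies :: "assignment \<Rightarrow> csp_constraint \<Rightarrow> bool" where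
  "satisfies \<tau> c = (case c of (t, R) \<Rightarrow> map \<tau> t \<in> R)"

definition csp_objective :: "csp_constraint list \<Rightarrow> (nat \<Rightarrow> real) \<Rightarrow> assignment \<Rightarrow> real" where
  "csp_objective cs w \<tau> = (\<Sum>i | i < length cs \<and> satisfies \<tau> (cs ! i). w i)"

type_synonym bfop_function = "(nat \<times> nat) \<times> (bool \<times> bool \<Rightarrow> nat)"

definition bfop_instance :: "nat \<Rightarrow> nat \<Rightarrow> bfop_function list \<Rightarrow> bool" where
  "bfop_instance k n fs \<longleftrightarrow>
     (\<forall>((u, v), f) \<in> set fs. u < n \<and> v < n \<and> range f \<subseteq> {0..k})"

definition bfop_value :: "assignment \<Rightarrow> bfop_function \<Rightarrow> nat" where
  "bfop_value \<tau> c = (case c of ((u, v), f) \<Rightarrow> f (\<tau> u, \<tau> v))"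

definition bfop_objective :: "bfop_function list \<Rightarrow> (nat \<Rightarrow> real) \<Rightarrow> assignment \<Rightarrow> real" where
  "bfop_objective fs w \<tau> = (\<Sum>i<length fs. w i * real (bfop_value \<tau> (fs ! i)))"

definition flip :: "nat \<Rightarrow> assignment \<Rightarrow> assignment" where
  "flip v \<tau> = \<tau>(v := \<not> \<tau> v)"

definition improving_vars :: "nat \<Rightarrow> (assignment \<Rightarrow> real) \<Rightarrow> assignment \<Rightarrow> nat set" where
  "improving_vars n obj \<tau> = {v. v < n \<and> obj (flip v \<tau>) > obj \<tau>}"

text \<open>
  A pivoting rule sees the whole history of the run (the list of assignments visited so far,
  the current one last) and must return an improving variable whenever there is one. A
  randomised rule is covered by quantifying over all rules of this kind.
\<close>

definition pivoting_rule ::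
    "nat \<Rightarrow> (assignment \<Rightarrow> real) \<Rightarrow> (assignment list \<Rightarrow> nat) \<Rightarrow> bool" where
  "pivoting_rule n obj \<rho> \<longleftrightarrow>
     (\<forall>h. h \<noteq> [] \<longrightarrow> improving_vars n obj (last h) \<noteq> {} \<longrightarrow> \<rho> h \<in> improving_vars n obj (last h))"

text \<open>The history of the run after \<open>s\<close> rounds; it is left unchanged once the run has stopped.\<close>

primrec flip_run ::
    "nat \<Rightarrow> (assignment \<Rightarrow> real) \<Rightarrow> (assignment list \<Rightarrow> nat) \<Rightarrow> assignment \<Rightarrow> nat \<Rightarrow> assignment list"
  where
    "flip_run n obj \<rho> \<tau>0 0 = [\<tau>0]"
  | "flip_run n obj \<rho> \<tau>0 (Suc s) =
       (let h = flip_run n obj \<rho> \<tau>0 s in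
        if improving_vars n obj (last h) = {} then h else h @ [flip (\<rho> h) (last h)])"

definition flip_terminates_within ::
    "nat \<Rightarrow> (assignment \<Rightarrow> real) \<Rightarrow> (assignment list \<Rightarrow> nat) \<Rightarrow> assignment \<Rightarrow> real \<Rightarrow> bool" where
  "flip_terminates_within n obj \<rho> \<tau>0 B \<longleftrightarrow>
     (\<exists>s. real s \<le> B \<and> improving_vars n obj (last (flip_run n obj \<rho> \<tau>0 s)) = {})"

definition all_flip_terminate_within :: "nat \<Rightarrow> (assignment \<Rightarrow> real) \<Rightarrow> real \<Rightarrow> bool" where
  "all_flip_terminate_within n obj B \<longleftrightarrow>
     (\<forall>\<tau>0 \<rho>. pivoting_rule n obj \<rho> \<longrightarrow> flip_terminates_within n obj \<rho> \<tau>0 B)"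

definition bounded_density_dist :: "real \<Rightarrow> real measure \<Rightarrow> bool" where
  "bounded_density_dist \<phi> D \<longleftrightarrow>
     prob_space D \<and> (AE x in D. x \<in> {-1..1}) \<and>
     (\<exists>f \<in> borel_measurable borel. (\<forall>x. 0 \<le> f x \<and> f x \<le> \<phi>) \<and> D = density lborel (\<lambda>x. ennreal (f x)))"

end

theory Submission
  imports Defs "HOL-Real_Asymp.Real_Asymp"
begin

text \<open>
  It suffices that, with probability at least \<open>1 - 1 / n\<close>, no sequence of \<open>2 * n\<close> improving flips
  gains at most \<open>\<epsilon> = 1 / (\<phi> * n powr O(sqrt (ln n)))\<close> in each flip. Call two consecutive flips of
  one variable \<open>v\<close> an arc. The total gain of an arc is a linear form in the weights that only sees
  the variables which interact with \<open>v\<close> and differ at its two ends, so it does not depend on the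
  values of variables that are not flipped in between. A family of \<open>R\<close> arcs each having a private
  coordinate has all its gains in \<open>{0<..2 * \<epsilon>}\<close> with probability at most \<open>(2 * \<phi> * \<epsilon>) ^ R\<close>, and this
  beats the union bound if the \<open>R\<close> forms can be described by \<open>O(s * R)\<close> symbols of \<open>O(ln n)\<close> bits,
  where \<open>s\<close> is about \<open>sqrt (ln n)\<close>.

  Such a family exists in every sequence. If some window of length \<open>l\<close> contains more than
  \<open>l / (24 * s)\<close> variables that are flipped twice, or more than \<open>l / (24 * s)\<close> arcs that are crossed by
  an interacting variable flipped only once in the window, then all flips of the window are
  recorded. Otherwise averaging over all length scales \<open>2 ^ i\<close> and all positions yields a window in
  which the arcs of length about \<open>2 ^ i\<close> can be described cheaply: much slower variables rarely cross
  them, and of much faster variables only the few flips that separate two relevant times matter.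
\<close>

subsection \<open>Long move sequences\<close>

text \<open>The obstacle is that the values of all variables at the start of a window cannot be
  recorded: they would outweigh the small probabilities. Only values that influence some chosen form
  may be stored, and their number has to be \<open>O(s)\<close> per form. Each stored symbol ranges
  over polynomially many possibilities, so \<open>K = 400 * s\<close> symbols per form shrink the
  tolerated gain by a factor \<open>n powr O(s)\<close>, which is the final exponent. Why
  \<open>s\<close> is about \<open>sqrt (ln n)\<close>: a sequence of length
  \<open>N = 2 * n\<close> has \<open>s * s\<close> length scales. An arc is compared safely only
  with variables slower or faster by a factor of about \<open>2 ^ s\<close>; the band of
  \<open>O(s)\<close> scales in between costs \<open>O(s * N)\<close> in total, that is
  \<open>O(s)\<close> for each of the at least \<open>N / 4\<close> usable arcs. An arc is lost when
  the gaps of its own variable shrink by such a factor at one of its ends. This is visible at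
  \<open>s\<close> successive scales, and \<open>s * s\<close> scales with at most
  \<open>N / (12 * s)\<close> such places each leave only a constant fraction of lost arcs. The
  density threshold \<open>1 / (24 * s)\<close> is matched to this: above it, recording a whole
  window also costs \<open>O(s)\<close> per form.\<close>

lemma card_covering_windows:
  fixes a c d :: nat
  assumes "d > 0"
  shows "card {k. k < M \<and> k * d \<le> a \<and> a < (k + c) * d} \<le> c"
proof -
  have "{k. k < M \<and> k * d \<le> a \<and> a < (k + c) * d} \<subseteq> {a div d + 1 - c..<a div d + 1}"
  proof
    fix k assume "k \<in> {k. k < M \<and> k * d \<le> a \<and> a < (k + c) * d}"
    then have k: "k * d \<le> a" "a < (k + c) * d" by auto
    have "k \<le> a div d" using k(1) assms by (simp add: less_eq_div_iff_mult_less_eq)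
    moreover have "a div d < k + c" using k(2) assms by (simp add: div_less_iff_less_mult)
    ultimately show "k \<in> {a div d + 1 - c..<a div d + 1}" by auto
  qed
  then have "card {k. k < M \<and> k * d \<le> a \<and> a < (k + c) * d} \<le> card {a div d + 1 - c..<a div d + 1}"
    by (intro card_mono) auto
  then show ?thesis by simp
qed

lemma sum_card_le_multiplicity:
  assumes "finite T" "finite I" "\<And>x. x \<in> T \<Longrightarrow> card {i \<in> I. P i x} \<le> b"
  shows "(\<Sum>i\<in>I. card {x \<in> T. P i x}) \<le> b * card T"
proof -
  have "(\<Sum>i\<in>I. card {x \<in> T. P i x}) = (\<Sum>x\<in>T. card {i \<in> I. P i x})"
    by (rule sum_multicount_gen) (use assms in auto)
  also have "\<dots> \<le> (\<Sum>x\<in>T. b)" using assms(3) by (rule sum_mono)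
  finally show ?thesis by (simp add: mult.commute)
qed

lemma sum_card_windows:
  fixes pos :: "'a \<Rightarrow> nat"
  assumes "finite T" "d > 0"
  shows "(\<Sum>k<M. card {x \<in> T. k * d \<le> pos x \<and> pos x < (k + c) * d}) \<le> c * card T"
  by (rule sum_card_le_multiplicity) (use assms card_covering_windows in auto)

text \<open>Averaging that also keeps \<open>g i\<close> positive, so that the block selected with
  it is nonempty.\<close>

lemma exists_le_of_sum_le:
  fixes f g :: "'a \<Rightarrow> nat"
  assumes "finite I" "sum f I \<le> sum g I" "sum g I > 0"
  obtains i where "i \<in> I" "f i \<le> g i" "g i > 0"
proof -
  have "\<exists>i\<in>I. f i \<le> g i \<and> g i > 0"
  proof (rule ccontr)
    assume "\<not> ?thesis"
    then have *: "\<And>i. i \<in> I \<Longrightarrow> g i \<le> f i" "\<And>i. i \<in> I \<Longrightarrow> g i > 0 \<Longrightarrow> g i < f i" by force+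
    obtain i where "i \<in> I" "g i > 0" using assms(3) by (metis not_gr_zero sum.neutral)
    then have "sum g I < sum f I" using * assms(1) by (intro sum_strict_mono_ex1) auto
    then show False using assms(2) by simp
  qed
  then show ?thesis using that by blast
qed

text \<open>In the graph with edges from \<open>x\<close> to \<open>f x\<close>, in-degrees average
  at most 1, so some \<open>x\<close> has at most one preimage. Taking \<open>x\<close> and
  discarding \<open>f x\<close> and that preimage uses up at most three elements per element
  taken.\<close>

lemma exists_independent_third:
  fixes f :: "'a \<Rightarrow> 'a"
  assumes "finite V" "\<And>x. x \<in> V \<Longrightarrow> f x \<noteq> x"
  obtains I where "I \<subseteq> V" "card V \<le> 3 * card I" "\<And>x. x \<in> I \<Longrightarrow> f x \<notin> I"
proof -
  have "\<exists>I \<subseteq> V. card V \<le> 3 * card I \<and> (\<forall>x\<in>I. f x \<notin> I)"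
    using assms
  proof (induction V rule: finite_psubset_induct)
    case (psubset V)
    show ?case
    proof (cases "V = {}")
      case True then show ?thesis by simp
    next
      case False
      have "\<exists>x\<in>V. card {y \<in> V. f y = x} \<le> 1"
      proof (rule ccontr)
        assume "\<not> ?thesis"
        then have "\<And>x. x \<in> V \<Longrightarrow> 2 \<le> card {y \<in> V. f y = x}" by force
        then have "(\<Sum>x\<in>V. 2) \<le> (\<Sum>x\<in>V. card {y \<in> V. f y = x})" by (intro sum_mono)
        also have "\<dots> = card (\<Union>x\<in>V. {y \<in> V. f y = x})"
          using psubset.hyps by (subst card_UN_disjoint) auto
        also have "\<dots> \<le> card V" using psubset.hyps by (intro card_mono) auto
        finally show False using False psubset.hyps by (simp add: card_gt_0_iff)
      qed
      then obtain x where x: "x \<in> V" "card {y \<in> V. f y = x} \<le> 1" by blast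
      define D where "D = {x, f x} \<union> {y \<in> V. f y = x}"
      have fD: "finite D" using psubset.hyps by (auto simp: D_def)
      have cD: "card D \<le> 3"
      proof -
        have "card D \<le> card {x, f x} + card {y \<in> V. f y = x}"
          unfolding D_def by (rule card_Un_le)
        also have "card {x, f x} \<le> 2" by (simp add: card_insert_if)
        finally show ?thesis using x(2) by simp
      qed
      have "V - D \<subset> V" using x by (auto simp: D_def)
      from psubset.IH[OF this] psubset.prems obtain I
        where I: "I \<subseteq> V - D" "card (V - D) \<le> 3 * card I" "\<forall>x\<in>I. f x \<notin> I" by blast
      have fI: "finite I" using I(1) psubset.hyps finite_subset by blast
      have "x \<notin> I" using I(1) by (auto simp: D_def)
      have "card V \<le> card (V - D) + card D"
        by (metis add.commute card_Un_le card_mono diff_card_le_card_Diff fD le_diff_conv)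
      also have "\<dots> \<le> 3 * card (insert x I)"
        using I(2) cD fI \<open>x \<notin> I\<close> by simp
      finally have "card V \<le> 3 * card (insert x I)" .
      moreover have "\<forall>y\<in>insert x I. f y \<notin> insert x I"
        using I(1,3) psubset.prems x by (auto simp: D_def)
      moreover have "insert x I \<subseteq> V" using I(1) x by auto
      ultimately show ?thesis by blast
    qed
  qed
  then show ?thesis using that by blast
qed

lemma less_of_power2_less: "(2::nat) ^ a < 2 ^ b \<Longrightarrow> a < b"
  by simp

lemma div_block:
  fixes t d :: nat
  assumes "d > 0"
  shows "t div d * d \<le> t \<and> t < t div d * d + d"
  using assms by (metis div_mult_mod_eq le_add1 mod_less_divisor nat_add_left_cancel_less)

section \<open>Arcs and windows of a move sequence\<close>

locale move_sequence =
  fixes N :: nat and v :: "nat \<Rightarrow> nat" and adj :: "nat \<Rightarrow> nat \<Rightarrow> bool"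
begin

definition arcs :: "(nat \<times> nat) set" where
  "arcs = {(t, t'). t < t' \<and> t' < N \<and> v t = v t' \<and> (\<forall>r. t < r \<and> r < t' \<longrightarrow> v r \<noteq> v t)}"

text \<open>A local measure of speed: for large \<open>d\<close> the variable is slow around
  \<open>r\<close>. For \<open>d \<le> 1\<close> the condition always holds.\<close>

definition isolated :: "nat \<Rightarrow> nat \<Rightarrow> bool" where
  "isolated d r \<longleftrightarrow> (\<forall>r'<N. v r' = v r \<and> r' \<noteq> r \<longrightarrow> r' + d \<le> r \<or> r + d \<le> r')"

definition recurring :: "nat \<Rightarrow> nat \<Rightarrow> nat set" where
  "recurring p q = {v t |t t'. p \<le> t \<and> t < t' \<and> t' < q \<and> v t' = v t}"

definition crossed :: "nat \<Rightarrow> nat \<Rightarrow> (nat \<times> nat) set" where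
  "crossed p q = {(t, t') \<in> arcs. p \<le> t \<and> t' < q \<and>
     (\<exists>r. t < r \<and> r < t' \<and> adj (v t) (v r) \<and> (\<forall>r'. p \<le> r' \<and> r' < q \<and> v r' = v r \<longrightarrow> r' = r))}"

lemma finite_arcs: "finite arcs"
proof -
  have "arcs \<subseteq> {..<N} \<times> {..<N}" by (auto simp: arcs_def)
  then show ?thesis using finite_subset by blast
qed

lemma arc_unique_fst: "(t, a) \<in> arcs \<Longrightarrow> (t, b) \<in> arcs \<Longrightarrow> a = b"
  by (auto simp: arcs_def) (metis linorder_neqE_nat)

lemma arc_unique_snd: "(a, t) \<in> arcs \<Longrightarrow> (b, t) \<in> arcs \<Longrightarrow> a = b"
  by (auto simp: arcs_def) (metis linorder_neqE_nat)

lemma next_arc: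
  assumes "t < r" "r < N" "v r = v t"
  obtains t' where "(t, t') \<in> arcs" "t' \<le> r"
proof -
  define t' where "t' = (LEAST x. t < x \<and> v x = v t)"
  have P: "t < t' \<and> v t' = v t" unfolding t'_def by (rule LeastI[of _ r]) (use assms in auto)
  have le: "t' \<le> r" unfolding t'_def by (rule Least_le) (use assms in auto)
  have "v x \<noteq> v t" if "t < x" "x < t'" for x
    using not_less_Least[of x "\<lambda>x. t < x \<and> v x = v t"] that by (auto simp: t'_def)
  then have "(t, t') \<in> arcs" using P le assms by (auto simp: arcs_def)
  then show ?thesis using that le by blast
qed

lemma previous_arc:
  assumes "r < t" "t < N" "v r = v t"
  obtains t' where "(t', t) \<in> arcs" "r \<le> t'"
proof -
  define t' where "t' = (GREATEST x. x < t \<and> v x = v t)"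
  have P: "t' < t \<and> v t' = v t" unfolding t'_def
    by (rule GreatestI_nat[of _ r t]) (use assms in auto)
  have le: "r \<le> t'" unfolding t'_def by (rule Greatest_le_nat[of _ r t]) (use assms in auto)
  have "v x \<noteq> v t'" if "t' < x" "x < t" for x
    using Greatest_le_nat[of "\<lambda>x. x < t \<and> v x = v t" x t] that P by (fastforce simp: t'_def)
  then have "(t', t) \<in> arcs" using P le assms by (auto simp: arcs_def)
  then show ?thesis using that le by blast
qed

lemma recurringI: "p \<le> t \<Longrightarrow> t < t' \<Longrightarrow> t' < q \<Longrightarrow> v t' = v t \<Longrightarrow> v t \<in> recurring p q"
  by (auto simp: recurring_def)

lemma finite_recurring: "finite (recurring p q)"
proof -
  have "recurring p q \<subseteq> v ` {..<q}" by (auto simp: recurring_def)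
  then show ?thesis using finite_subset by blast
qed

lemma finite_crossed: "finite (crossed p q)"
  by (rule finite_subset[OF _ finite_arcs]) (auto simp: crossed_def)

lemma card_arcs_le: "card arcs \<le> N"
proof -
  have "inj_on fst arcs" by (auto simp: inj_on_def dest: arc_unique_fst)
  moreover have "fst ` arcs \<subseteq> {..<N}" by (auto simp: arcs_def)
  ultimately show ?thesis by (metis card_inj_on_le card_lessThan finite_lessThan)
qed

text \<open>A flip that starts no arc is the last flip of its variable, so there is at most one per
  variable.\<close>

lemma card_arcs_ge: "N \<le> card arcs + card (v ` {..<N})"
proof -
  define L where "L = {..<N} - fst ` arcs"
  have "inj_on v L"
  proof (rule inj_onI)
    fix x y assume xy: "x \<in> L" "y \<in> L" "v x = v y"
    have "\<not> a < b" if "a \<in> L" "b \<in> L" "v a = v b" for a b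
    proof
      assume "a < b"
      with that obtain t' where "(a, t') \<in> arcs" by (metis next_arc L_def DiffD1 lessThan_iff)
      then show False using that(1) by (force simp: L_def)
    qed
    with xy show "x = y" by (metis linorder_neqE_nat)
  qed
  moreover have "v ` L \<subseteq> v ` {..<N}" by (auto simp: L_def)
  ultimately have "card L \<le> card (v ` {..<N})" by (intro card_inj_on_le) auto
  moreover have "card (fst ` arcs) \<le> card arcs" by (rule card_image_le[OF finite_arcs])
  moreover have "card {..<N} \<le> card L + card (fst ` arcs)"
    unfolding L_def by (metis diff_card_le_card_Diff finite_arcs finite_imageI le_diff_conv)
  ultimately show ?thesis by simp
qed

end

section \<open>Counting arcs over all scales when every window is sparse\<close>

locale sparse_sequence = move_sequence +
  fixes s :: nat
  assumes s_pos: "s > 0" and N_le: "N \<le> 2 ^ (s * s)"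
    and nodes: "2 * card (v ` {..<N}) \<le> N"
    and sparse_recurring: "\<And>p q. p < q \<Longrightarrow> q \<le> N \<Longrightarrow> 24 * s * card (recurring p q) \<le> q - p"
    and sparse_crossed: "\<And>p q. p < q \<Longrightarrow> q \<le> N \<Longrightarrow> 24 * s * card (crossed p q) \<le> q - p"
begin

lemma card_window: "card {t \<in> {..<N}. p \<le> t \<and> t < q} = min N q - p"
proof -
  have "{t \<in> {..<N}. p \<le> t \<and> t < q} = {p..<min N q}" by auto
  then show ?thesis by simp
qed

lemma sparse_recurring':
  "24 * s * card (recurring p (min N q)) \<le> card {t \<in> {..<N}. p \<le> t \<and> t < q}"
proof (cases "p < min N q")
  case True
  then show ?thesis using sparse_recurring[of p "min N q"] card_window by simp
next
  case False
  then have "recurring p (min N q) = {}" by (auto simp: recurring_def)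
  then show ?thesis by simp
qed

lemma sparse_crossed':
  "24 * s * card (crossed p (min N q)) \<le> card {t \<in> {..<N}. p \<le> t \<and> t < q}"
proof (cases "p < min N q")
  case True
  then show ?thesis using sparse_crossed[of p "min N q"] card_window by simp
next
  case False
  then have "crossed p (min N q) = {}" by (auto simp: crossed_def arcs_def)
  then show ?thesis by simp
qed

text \<open>Windows of \<open>c\<close> blocks starting at the multiples of \<open>d\<close> cover
  each time at most \<open>c\<close> times. The shift \<open>e\<close> lets a window reach back into
  earlier blocks; truncated subtraction merely clips it at time 0.\<close>

lemma sum_recurring:
  assumes "d > 0"
  shows "24 * s * (\<Sum>k<M. card (recurring (k * d - e) (min N ((k + c) * d - e)))) \<le> c * N"
proof -
  have "24 * s * (\<Sum>k<M. card (recurring (k * d - e) (min N ((k + c) * d - e)))) =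
      (\<Sum>k<M. 24 * s * card (recurring (k * d - e) (min N ((k + c) * d - e))))"
    by (simp add: sum_distrib_left)
  also have "\<dots> \<le> (\<Sum>k<M. card {t \<in> {..<N}. k * d - e \<le> t \<and> t < (k + c) * d - e})"
    by (intro sum_mono sparse_recurring')
  also have "\<dots> = (\<Sum>k<M. card {t \<in> {..<N}. k * d \<le> t + e \<and> t + e < (k + c) * d})"
    by (intro sum.cong arg_cong[where f = card]) auto
  also have "\<dots> \<le> c * N"
    using sum_card_windows[of "{..<N}" d "\<lambda>t. t + e"] assms by auto
  finally show ?thesis .
qed

definition pierced :: "nat \<Rightarrow> (nat \<times> nat) set" where
  "pierced D = {(t, t') \<in> arcs. \<exists>r. t < r \<and> r < t' \<and> adj (v t) (v r) \<and> isolated D r}"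

lemma finite_pierced: "finite (pierced D)"
  by (rule finite_subset[OF _ finite_arcs]) (auto simp: pierced_def)

text \<open>An arc of length at most \<open>d\<close> lies in a window of two adjacent blocks of
  length \<open>d\<close>. There a flip isolated at \<open>2 * d\<close> is the only one of its
  variable, so the arc belongs to \<open>crossed\<close> of that window. Each time lies in two
  windows, which turns 24 into 12.\<close>

lemma card_pierced:
  assumes "d > 0"
  shows "12 * s * card {(t, t') \<in> pierced (2 * d). t' \<le> t + d} \<le> N"
proof -
  let ?P = "{(t, t') \<in> pierced (2 * d). t' \<le> t + d}"
  have "?P \<subseteq> (\<Union>k<N. crossed (k * d) (min N ((k + 2) * d)))"
  proof
    fix x assume "x \<in> ?P"
    then obtain t t' r where x: "x = (t, t')" "(t, t') \<in> arcs" "t < r" "r < t'" "adj (v t) (v r)"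
      "isolated (2 * d) r" "t' \<le> t + d" by (auto simp: pierced_def)
    let ?k = "t div d"
    have "t < N" "t' < N" using x(2) by (auto simp: arcs_def)
    have "?k \<le> t" by simp
    have lo: "?k * d \<le> t" by simp
    have "t < (?k + 1) * d" using assms by (simp add: dividend_less_div_times)
    then have hi: "t' < (?k + 2) * d" using x(7) by (simp add: algebra_simps)
    have "r' = r" if "?k * d \<le> r'" "r' < min N ((?k + 2) * d)" "v r' = v r" for r'
    proof (rule ccontr)
      assume "r' \<noteq> r"
      then have "r' + 2 * d \<le> r \<or> r + 2 * d \<le> r'" using x(6) that by (auto simp: isolated_def)
      moreover have "?k * d \<le> r" "r < (?k + 2) * d" using x(3,4) lo hi by linarith+
      ultimately show False using that by (auto simp: algebra_simps)
    qed
    then have "x \<in> crossed (?k * d) (min N ((?k + 2) * d))"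
      using x lo hi \<open>t' < N\<close> unfolding crossed_def by auto
    then show "x \<in> (\<Union>k<N. crossed (k * d) (min N ((k + 2) * d)))"
      using \<open>t < N\<close> \<open>?k \<le> t\<close> by (meson UN_I le_less_trans lessThan_iff)
  qed
  then have "card ?P \<le> card (\<Union>k<N. crossed (k * d) (min N ((k + 2) * d)))"
    by (intro card_mono finite_UN_I) (auto simp: finite_crossed)
  also have "\<dots> \<le> (\<Sum>k<N. card (crossed (k * d) (min N ((k + 2) * d))))"
    by (rule card_UN_le) simp
  finally have "24 * s * card ?P \<le> 24 * s * (\<Sum>k<N. card (crossed (k * d) (min N ((k + 2) * d))))"
    by simp
  also have "\<dots> = (\<Sum>k<N. 24 * s * card (crossed (k * d) (min N ((k + 2) * d))))"
    by (simp add: sum_distrib_left)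
  also have "\<dots> \<le> (\<Sum>k<N. card {t \<in> {..<N}. k * d \<le> t \<and> t < (k + 2) * d})"
    by (intro sum_mono sparse_crossed')
  also have "\<dots> \<le> 2 * N"
    using sum_card_windows[of "{..<N}" d "\<lambda>t. t" 2 N] assms by (simp del: add_2_eq_Suc')
  finally show ?thesis by simp
qed

text \<open>The places where the gaps between flips of a variable fall from at least
  \<open>2 ^ g\<close> to less; a first flip counts as preceded by a long gap.
  \<open>left_edge\<close> is the mirror image.\<close>

definition right_edge :: "nat \<Rightarrow> nat set" where
  "right_edge g = {t. t < N \<and> (\<forall>r<t. v r = v t \<longrightarrow> r + 2 ^ g \<le> t) \<and>
     (\<exists>r. t < r \<and> r < N \<and> v r = v t \<and> r < t + 2 ^ g)}"

definition left_edge :: "nat \<Rightarrow> nat set" where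
  "left_edge g = {t. t < N \<and> (\<forall>r. t < r \<and> r < N \<and> v r = v t \<longrightarrow> t + 2 ^ g \<le> r) \<and>
     (\<exists>r. r < t \<and> v r = v t \<and> t < r + 2 ^ g)}"

lemma finite_edges: "finite (right_edge g)" "finite (left_edge g)"
  by (rule finite_subset[of _ "{..<N}"]; force simp: right_edge_def left_edge_def)+

text \<open>Edges of one variable are at least \<open>d\<close> apart, so a block of length
  \<open>d\<close> holds at most one of them, and it is charged to the recurrence of that variable
  in a window of two blocks.\<close>

lemma card_edge_aux:
  assumes E: "finite E" "\<And>t. t \<in> E \<Longrightarrow> t < N"
    and inj: "\<And>t t'. t \<in> E \<Longrightarrow> t' \<in> E \<Longrightarrow> t < t' \<Longrightarrow> v t = v t' \<Longrightarrow> t + d \<le> t'"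
    and rec: "\<And>t. t \<in> E \<Longrightarrow> v t \<in> recurring (t div d * d - e) (min N ((t div d + 2) * d - e))"
    and "d > 0"
  shows "12 * s * card E \<le> N"
proof -
  let ?S = "SIGMA k:{..<N}. recurring (k * d - e) (min N ((k + 2) * d - e))"
  have "inj_on (\<lambda>t. (t div d, v t)) E"
  proof (rule inj_onI)
    fix x y assume xy: "x \<in> E" "y \<in> E" "(x div d, v x) = (y div d, v y)"
    have "\<not> a < b" if "a \<in> E" "b \<in> E" "a div d = b div d" "v a = v b" for a b
    proof
      assume "a < b"
      then have "a + d \<le> b" using inj that by blast
      then have "(a + d) div d \<le> b div d" by (rule div_le_mono)
      moreover have "(a + d) div d = a div d + 1" using \<open>d > 0\<close> by (simp add: div_add_self2)
      ultimately show False using that(3) by simp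
    qed
    with xy show "x = y" by (metis Pair_inject linorder_neqE_nat)
  qed
  moreover have "(\<lambda>t. (t div d, v t)) ` E \<subseteq> ?S"
    using rec E(2) by (auto intro: le_less_trans[OF div_le_dividend] simp del: add_2_eq_Suc')
  ultimately have "card E \<le> card ?S" by (intro card_inj_on_le) (auto simp: finite_recurring)
  also have "\<dots> = (\<Sum>k<N. card (recurring (k * d - e) (min N ((k + 2) * d - e))))"
    by (rule card_SigmaI) (auto simp: finite_recurring)
  finally have "24 * s * card E \<le> 24 * s * (\<Sum>k<N. card (recurring (k * d - e) (min N ((k + 2) * d - e))))"
    by simp
  also have "\<dots> \<le> 2 * N" by (rule sum_recurring[OF \<open>d > 0\<close>])
  finally show ?thesis by simp
qed

lemma card_right_edge: "12 * s * card (right_edge g) \<le> N"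
proof (rule card_edge_aux[where d = "2 ^ g" and e = 0])
  fix t assume "t \<in> right_edge g"
  then obtain r where r: "t < r" "r < N" "v r = v t" "r < t + 2 ^ g" by (auto simp: right_edge_def)
  have "t div 2 ^ g * 2 ^ g \<le> t" "t < t div 2 ^ g * 2 ^ g + 2 ^ g"
    using div_block[of "2 ^ g" t] by simp_all
  moreover have "(t div 2 ^ g + 2) * 2 ^ g = t div 2 ^ g * 2 ^ g + 2 ^ g + 2 ^ g"
    by (simp add: algebra_simps)
  ultimately have "t div 2 ^ g * 2 ^ g - 0 \<le> t" "r < min N ((t div 2 ^ g + 2) * 2 ^ g - 0)"
    using r by linarith+
  then show "v t \<in> recurring (t div 2 ^ g * 2 ^ g - 0) (min N ((t div 2 ^ g + 2) * 2 ^ g - 0))"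
    by (intro recurringI[where t' = r]) (use r in auto)
qed (auto simp: finite_edges right_edge_def)

lemma card_left_edge: "12 * s * card (left_edge g) \<le> N"
proof (rule card_edge_aux[where d = "2 ^ g" and e = "2 ^ g"])
  fix t assume "t \<in> left_edge g"
  then obtain r where r: "t < N" "r < t" "v r = v t" "t < r + 2 ^ g" by (auto simp: left_edge_def)
  have "t div 2 ^ g * 2 ^ g \<le> t" "t < t div 2 ^ g * 2 ^ g + 2 ^ g"
    using div_block[of "2 ^ g" t] by simp_all
  moreover have "(t div 2 ^ g + 2) * 2 ^ g = t div 2 ^ g * 2 ^ g + 2 ^ g + 2 ^ g"
    by (simp add: algebra_simps)
  ultimately have "t div 2 ^ g * 2 ^ g - 2 ^ g \<le> r" "t < min N ((t div 2 ^ g + 2) * 2 ^ g - 2 ^ g)"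
    using r by linarith+
  then have "v r \<in> recurring (t div 2 ^ g * 2 ^ g - 2 ^ g) (min N ((t div 2 ^ g + 2) * 2 ^ g - 2 ^ g))"
    by (intro recurringI[where t' = t]) (use r in auto)
  then show "v t \<in> recurring (t div 2 ^ g * 2 ^ g - 2 ^ g) (min N ((t div 2 ^ g + 2) * 2 ^ g - 2 ^ g))"
    using r by simp
qed (auto simp: finite_edges left_edge_def)

definition arc_class :: "nat \<Rightarrow> (nat \<times> nat) set" where
  "arc_class i = {(t, t') \<in> arcs. t + 2 ^ i \<le> t' \<and> t' < t + 2 ^ (i + 1)}"

lemma finite_arc_class: "finite (arc_class i)"
  by (rule finite_subset[OF _ finite_arcs]) (auto simp: arc_class_def)

lemma arc_class_unique: "x \<in> arc_class i \<Longrightarrow> x \<in> arc_class j \<Longrightarrow> i = j"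
proof -
  have "\<not> a < b" if "x \<in> arc_class a" "x \<in> arc_class b" for a b
  proof
    assume "a < b"
    then have "(2::nat) ^ (a + 1) \<le> 2 ^ b" by (intro power_increasing) auto
    then show False using that by (auto simp: arc_class_def)
  qed
  then show "x \<in> arc_class i \<Longrightarrow> x \<in> arc_class j \<Longrightarrow> i = j" by (metis linorder_neqE_nat)
qed

lemma arcs_eq_UN_class: "arcs = (\<Union>i<s * s. arc_class i)"
proof
  show "arcs \<subseteq> (\<Union>i<s * s. arc_class i)"
  proof
    fix x assume x: "x \<in> arcs"
    then obtain t t' where tt: "x = (t, t')" "t < t'" "t' < N" by (auto simp: arcs_def)
    obtain i where i: "2 ^ i \<le> t' - t" "t' - t < 2 ^ (i + 1)"
      using ex_power_ivl1[of 2 "t' - t"] tt by (metis One_nat_def Suc_leI order_refl zero_less_diff)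
    have "(2::nat) ^ i < 2 ^ (s * s)" using i(1) tt(3) N_le by linarith
    then have "i < s * s" by simp
    moreover have "x \<in> arc_class i" using x tt i by (auto simp: arc_class_def)
    ultimately show "x \<in> (\<Union>i<s * s. arc_class i)" by blast
  qed
qed (auto simp: arc_class_def)

lemma sum_card_class:
  assumes "finite I"
  shows "(\<Sum>i\<in>I. card (arc_class i)) = card (\<Union>i\<in>I. arc_class i)"
  using assms finite_arc_class arc_class_unique by (intro card_UN_disjoint[symmetric]) blast+

text \<open>Next to such an arc the gap of its variable is shorter by a factor of about
  \<open>2 ^ s\<close>. The set is empty for \<open>i \<le> s\<close>, where truncated subtraction
  makes the distance 1.\<close>

definition drops :: "nat \<Rightarrow> (nat \<times> nat) set" where
  "drops i = {(t, t') \<in> arc_class i. \<not> isolated (2 ^ (i - s)) t \<or> \<not> isolated (2 ^ (i - s)) t'}"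

lemma sum_drops_aux:
  assumes sub: "\<And>i. A i \<subseteq> arc_class i"
    and inj: "\<And>x y. x \<in> arcs \<Longrightarrow> y \<in> arcs \<Longrightarrow> pos x = pos y \<Longrightarrow> x = y"
    and mem: "\<And>i j x. x \<in> A i \<Longrightarrow> j < s \<Longrightarrow> s \<le> i \<and> pos x \<in> E (i - j)"
    and E: "\<And>g. finite (E g)" "\<And>g. 12 * s * card (E g) \<le> N"
  shows "12 * (\<Sum>i<s * s. card (A i)) \<le> N"
proof -
  let ?D = "(SIGMA i:{..<s * s}. A i) \<times> {..<s}" and ?f = "\<lambda>(x, j). (fst x - j, pos (snd x))"
  have finA: "finite (A i)" for i using sub finite_arc_class finite_subset by blast
  have "inj_on ?f ?D"
  proof (rule inj_onI)
    fix p q assume pq: "p \<in> ?D" "q \<in> ?D" "?f p = ?f q"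
    obtain i x j where p: "p = ((i, x), j)" by (metis surj_pair)
    obtain i' x' j' where q: "q = ((i', x'), j')" by (metis surj_pair)
    have x: "x \<in> arc_class i" "x' \<in> arc_class i'" using pq p q sub by auto
    then have "x \<in> arcs" "x' \<in> arcs" by (auto simp: arc_class_def)
    then have xx: "x = x'" using inj pq p q by auto
    then have ii: "i = i'" using x arc_class_unique by blast
    \<comment> \<open>Without truncation in \<open>i - j\<close>, the number \<open>j\<close> can be
      read off from \<open>i\<close> and \<open>i - j\<close>.\<close>
    have "s \<le> i" using mem[of x i j] pq p by auto
    then have "j = j'" using pq p q ii by auto
    with xx ii p q show "p = q" by simp
  qed
  moreover have "?f ` ?D \<subseteq> (SIGMA g:{..<s * s}. E g)"
    using mem by fastforce
  ultimately have "card ?D \<le> card (SIGMA g:{..<s * s}. E g)"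
    by (intro card_inj_on_le) (auto simp: E)
  then have "s * (\<Sum>i<s * s. card (A i)) \<le> (\<Sum>g<s * s. card (E g))"
    by (simp add: card_cartesian_product finA E(1) mult.commute)
  then have "12 * s * (s * (\<Sum>i<s * s. card (A i))) \<le> 12 * s * (\<Sum>g<s * s. card (E g))"
    by simp
  also have "\<dots> = (\<Sum>g<s * s. 12 * s * card (E g))" by (simp add: sum_distrib_left)
  also have "\<dots> \<le> (\<Sum>g<s * s. N)" by (intro sum_mono E)
  finally have "(s * s) * (12 * (\<Sum>i<s * s. card (A i))) \<le> (s * s) * N" by (simp add: ac_simps)
  then show ?thesis using s_pos by simp
qed

text \<open>
  An end of an arc in \<open>drops i\<close> is an edge for all \<open>s\<close> exponents from \<open>i - s + 1\<close> to \<open>i\<close>, whereas there are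
  few edges for each of the \<open>s * s\<close> exponents.
\<close>

lemma sum_drops: "6 * (\<Sum>i<s * s. card (drops i)) \<le> N"
proof -
  define R where "R i = {(t, t') \<in> arc_class i. \<exists>r. t' < r \<and> r < N \<and> v r = v t' \<and> r < t' + 2 ^ (i - s)}" for i
  define L where "L i = {(t, t') \<in> arc_class i. \<exists>r. r < t \<and> v r = v t \<and> t < r + 2 ^ (i - s)}" for i
  have R: "12 * (\<Sum>i<s * s. card (R i)) \<le> N"
  proof (rule sum_drops_aux[where pos = snd and E = right_edge])
    fix i j x assume x: "x \<in> R i" and j: "j < s"
    then obtain t t' r where tt: "x = (t, t')" "(t, t') \<in> arc_class i" "t' < r" "r < N" "v r = v t'"
      "r < t' + 2 ^ (i - s)" by (auto simp: R_def)
    \<comment> \<open>For \<open>i < s\<close> the distance \<open>2 ^ (i - s)\<close> is 1, which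
      leaves no room for \<open>r\<close>.\<close>
    have si: "s \<le> i" using tt(3,6) by (cases "s \<le> i") auto
    have p: "(2::nat) ^ (i - s) \<le> 2 ^ (i - j)" "(2::nat) ^ (i - j) \<le> 2 ^ i"
      using j by (auto intro!: power_increasing)
    have "r' + 2 ^ (i - j) \<le> t'" if "r' < t'" "v r' = v t'" for r'
    proof -
      have "r' \<le> t" using tt(2) that by (auto simp: arc_class_def arcs_def) (metis leI)
      moreover have "t + 2 ^ i \<le> t'" using tt(2) by (simp add: arc_class_def)
      ultimately show ?thesis using p(2) by linarith
    qed
    moreover have "\<exists>r. t' < r \<and> r < N \<and> v r = v t' \<and> r < t' + 2 ^ (i - j)"
      using tt(3-6) order.strict_trans2[OF tt(6), of "t' + 2 ^ (i - j)"] p(1)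
      by (intro exI[of _ r]) linarith
    ultimately show "s \<le> i \<and> snd x \<in> right_edge (i - j)"
      using si tt by (auto simp: right_edge_def)
  qed (auto simp: R_def arc_class_def finite_edges card_right_edge dest: arc_unique_snd)
  have L: "12 * (\<Sum>i<s * s. card (L i)) \<le> N"
  proof (rule sum_drops_aux[where pos = fst and E = left_edge])
    fix i j x assume x: "x \<in> L i" and j: "j < s"
    then obtain t t' r where tt: "x = (t, t')" "(t, t') \<in> arc_class i" "r < t" "v r = v t"
      "t < r + 2 ^ (i - s)" by (auto simp: L_def)
    have si: "s \<le> i" using tt(3,5) by (cases "s \<le> i") auto
    have p: "(2::nat) ^ (i - s) \<le> 2 ^ (i - j)" "(2::nat) ^ (i - j) \<le> 2 ^ i"
      using j by (auto intro!: power_increasing)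
    have "t + 2 ^ (i - j) \<le> r'" if "t < r'" "v r' = v t" for r'
    proof -
      have "t' \<le> r'" using tt(2) that by (auto simp: arc_class_def arcs_def leI)
      moreover have "t + 2 ^ i \<le> t'" using tt(2) by (simp add: arc_class_def)
      ultimately show ?thesis using p(2) by linarith
    qed
    moreover have "\<exists>r. r < t \<and> v r = v t \<and> t < r + 2 ^ (i - j)"
      using tt(3-5) order.strict_trans2[OF tt(5), of "r + 2 ^ (i - j)"] p(1)
      by (intro exI[of _ r]) linarith
    moreover have "t < N" using tt(2) by (auto simp: arc_class_def arcs_def)
    ultimately show "s \<le> i \<and> fst x \<in> left_edge (i - j)"
      using si tt by (auto simp: left_edge_def)
  qed (auto simp: L_def arc_class_def finite_edges card_left_edge dest: arc_unique_fst)
  have sub: "drops i \<subseteq> R i \<union> L i" for i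
  proof
    fix x assume "x \<in> drops i"
    then obtain t t' where x: "x = (t, t')" "(t, t') \<in> arc_class i"
      "\<not> isolated (2 ^ (i - s)) t \<or> \<not> isolated (2 ^ (i - s)) t'" by (auto simp: drops_def)
    have a: "t < t'" "t' < N" "v t = v t'" "\<And>r. t < r \<Longrightarrow> r < t' \<Longrightarrow> v r \<noteq> v t" "t + 2 ^ i \<le> t'"
      using x(2) by (auto simp: arc_class_def arcs_def)
    have p: "(2::nat) ^ (i - s) \<le> 2 ^ i" by (intro power_increasing) auto
    from x(3) show "x \<in> R i \<union> L i"
    proof
      assume "\<not> isolated (2 ^ (i - s)) t"
      then obtain r where r: "r < N" "v r = v t" "r \<noteq> t" "t < r + 2 ^ (i - s)" "r < t + 2 ^ (i - s)"
        by (auto simp: isolated_def)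
      have "\<not> t < r" using r(2,5) a(4)[of r] a(5) p by linarith
      then have "r < t" using r by simp
      then show ?thesis using r x by (auto simp: L_def)
    next
      assume "\<not> isolated (2 ^ (i - s)) t'"
      then obtain r where r: "r < N" "v r = v t'" "r \<noteq> t'" "t' < r + 2 ^ (i - s)" "r < t' + 2 ^ (i - s)"
        by (auto simp: isolated_def)
      have "\<not> r < t'"
      proof
        assume "r < t'"
        then have "r \<le> t" using a(3) a(4)[of r] r(2) by force
        then show False using r(4) a(5) p by linarith
      qed
      then have "t' < r" using r by simp
      then show ?thesis using r x by (auto simp: R_def)
    qed
  qed
  have "card (drops i) \<le> card (R i) + card (L i)" for i
  proof -
    have "finite (R i)" "finite (L i)"
      by (rule finite_subset[OF _ finite_arc_class[of i]]; auto simp: R_def L_def)+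
    then show ?thesis by (meson card_Un_le card_mono finite_UnI le_trans sub)
  qed
  then have "(\<Sum>i<s * s. card (drops i)) \<le> (\<Sum>i<s * s. card (R i)) + (\<Sum>i<s * s. card (L i))"
    by (simp add: sum.distrib[symmetric] sum_mono)
  then show ?thesis using R L by linarith
qed

text \<open>
  The horizon is constant on blocks of \<open>s\<close> consecutive classes, so that \<open>card_pierced\<close> is summed over
  \<open>s\<close> horizons only rather than over \<open>s * s\<close> classes.
\<close>

definition horizon :: "nat \<Rightarrow> nat" where
  "horizon i = 2 ^ (s * (i div s + 1))"

text \<open>Removing \<open>drops\<close> makes the ends of an arc isolated, which limits the arcs
  of other variables that are counted across these ends (\<open>spans\<close>). Removing
  \<open>pierced\<close> ensures that every interacting variable flipped inside the arc is flipped
  another time at distance less than \<open>2 * horizon i\<close>, hence is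
  \<open>exposed\<close>.\<close>

definition good :: "nat \<Rightarrow> (nat \<times> nat) set" where
  "good i = arc_class i - drops i - pierced (2 * horizon i)"

lemma finite_good: "finite (good i)"
  using finite_arc_class by (auto simp: good_def)

lemma power_le_horizon: "2 ^ (i + 1) \<le> horizon i"
proof -
  have "i < s * (i div s + 1)" using s_pos
    by (metis add.commute dividend_less_times_div mult_Suc_right plus_1_eq_Suc)
  then show ?thesis unfolding horizon_def by (intro power_increasing) auto
qed

lemma horizon_le: "horizon i \<le> 2 ^ (i + s)"
proof -
  have "s * (i div s + 1) \<le> i + s" by simp
  then show ?thesis unfolding horizon_def by (intro power_increasing) auto
qed

lemma sum_pierced_class: "12 * (\<Sum>i<s * s. card (arc_class i \<inter> pierced (2 * horizon i))) \<le> N"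
proof -
  let ?f = "\<lambda>i. card (arc_class i \<inter> pierced (2 * horizon i))"
  have part: "12 * s * sum ?f {a * s..<a * s + s} \<le> N" for a
  proof -
    let ?H = "2 ^ (s * (a + 1)) :: nat" and ?I = "{a * s..<a * s + s}"
    have "i div s = a" if "i \<in> ?I" for i
      using that s_pos by (metis add.commute atLeastLessThan_iff div_nat_eqI mult.commute mult_Suc)
    then have H: "horizon i = ?H" if "i \<in> ?I" for i using that by (simp add: horizon_def)
    have "sum ?f ?I = card (\<Union>i\<in>?I. arc_class i \<inter> pierced (2 * horizon i))"
      using finite_arc_class arc_class_unique by (intro card_UN_disjoint[symmetric]) blast+
    also have "\<dots> \<le> card {(t, t') \<in> pierced (2 * ?H). t' \<le> t + ?H}"
    proof (rule card_mono)
      show "finite {(t, t') \<in> pierced (2 * ?H). t' \<le> t + ?H}"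
        by (rule finite_subset[OF _ finite_pierced]) auto
      show "(\<Union>i\<in>?I. arc_class i \<inter> pierced (2 * horizon i)) \<subseteq> {(t, t') \<in> pierced (2 * ?H). t' \<le> t + ?H}"
      proof
        fix x assume "x \<in> (\<Union>i\<in>?I. arc_class i \<inter> pierced (2 * horizon i))"
        then obtain i where i: "i \<in> ?I" "x \<in> arc_class i" "x \<in> pierced (2 * ?H)" using H by auto
        then show "x \<in> {(t, t') \<in> pierced (2 * ?H). t' \<le> t + ?H}"
          using power_le_horizon[of i] H[OF i(1)] by (auto simp: arc_class_def)
      qed
    qed
    finally have "12 * s * sum ?f ?I \<le> 12 * s * card {(t, t') \<in> pierced (2 * ?H). t' \<le> t + ?H}" by simp
    also have "\<dots> \<le> N" by (rule card_pierced) simp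
    finally show ?thesis .
  qed
  have "12 * s * (\<Sum>i<s * s. ?f i) = (\<Sum>a<s. 12 * s * sum ?f {a * s..<a * s + s})"
    by (simp add: sum_distrib_left[symmetric] sum.nat_group)
  also have "\<dots> \<le> (\<Sum>a<s. N)" by (intro sum_mono part)
  finally have "s * (12 * (\<Sum>i<s * s. ?f i)) \<le> s * N" by (simp add: ac_simps)
  then show ?thesis using s_pos by simp
qed

text \<open>By \<open>nodes\<close> there are at least \<open>N / 2\<close> arcs; at most
  \<open>N / 6\<close> are lost to \<open>drops\<close> and \<open>N / 12\<close> to
  \<open>pierced\<close>.\<close>

lemma sum_good: "N \<le> 4 * (\<Sum>i<s * s. card (good i))"
proof -
  have "card (arc_class i) \<le> card (good i) + card (drops i) + card (arc_class i \<inter> pierced (2 * horizon i))" for i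
  proof -
    have "finite (drops i)" by (rule finite_subset[OF _ finite_arc_class[of i]]) (auto simp: drops_def)
    moreover have "arc_class i \<subseteq> (good i \<union> drops i) \<union> (arc_class i \<inter> pierced (2 * horizon i))"
      by (auto simp: good_def)
    ultimately have "card (arc_class i) \<le> card ((good i \<union> drops i) \<union> (arc_class i \<inter> pierced (2 * horizon i)))"
      using finite_good finite_arc_class by (intro card_mono) auto
    also have "\<dots> \<le> card (good i \<union> drops i) + card (arc_class i \<inter> pierced (2 * horizon i))"
      by (rule card_Un_le)
    finally show ?thesis using card_Un_le[of "good i" "drops i"] by linarith
  qed
  then have "(\<Sum>i<s * s. card (arc_class i)) \<le> (\<Sum>i<s * s. card (good i) + card (drops i) +
      card (arc_class i \<inter> pierced (2 * horizon i)))" by (intro sum_mono)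
  moreover have "(\<Sum>i<s * s. card (arc_class i)) = card arcs"
    using sum_card_class[of "{..<s * s}"] arcs_eq_UN_class by simp
  ultimately have "12 * card arcs \<le> 12 * (\<Sum>i<s * s. card (good i)) + 12 * (\<Sum>i<s * s. card (drops i)) +
      12 * (\<Sum>i<s * s. card (arc_class i \<inter> pierced (2 * horizon i)))"
    by (simp add: sum.distrib)
  then show ?thesis using sum_pierced_class sum_drops card_arcs_ge nodes by linarith
qed

section \<open>The cost of describing the arcs of one block\<close>

definition exposed :: "nat \<Rightarrow> nat \<Rightarrow> nat set" where
  "exposed i k = {v r |r. k * 2 ^ (i + 1) \<le> r \<and> r < min N ((k + 2) * 2 ^ (i + 1)) \<and>
     \<not> isolated (2 * horizon i) r}"

text \<open>The flips \<open>m\<close> stand for ends of good arcs, which are isolated at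
  \<open>2 ^ (i - s)\<close>. A flip of an interacting variable that is still current at such an end
  starts one of these arcs, unless it is the last flip of its variable in the window.\<close>

definition spans :: "nat \<Rightarrow> nat \<Rightarrow> (nat \<times> nat) set" where
  "spans i k = {(t, t') \<in> arcs. k * 2 ^ (i + 1) \<le> t \<and> t' < (k + 2) * 2 ^ (i + 1) \<and>
     (\<exists>m. t < m \<and> m < t' \<and> adj (v t) (v m) \<and> isolated (2 ^ (i - s)) m)}"

definition long_arcs :: "nat \<Rightarrow> (nat \<times> nat) set" where
  "long_arcs i = {x \<in> arcs. fst x + 2 ^ (i + 1) \<le> snd x \<and> snd x < fst x + 2 * horizon i}"

definition middle_arcs :: "nat \<Rightarrow> (nat \<times> nat) set" where
  "middle_arcs i = {x \<in> arcs. fst x + 2 ^ (i - s - 1) < snd x \<and> snd x < fst x + 2 ^ (i + 2)}"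

definition short_spans :: "nat \<Rightarrow> (nat \<times> nat) set" where
  "short_spans i = {(t, t') \<in> pierced (2 ^ (i - s)). t' \<le> t + 2 ^ (i - s - 1)}"

lemma finite_arc_families: "finite (long_arcs i)" "finite (middle_arcs i)" "finite (short_spans i)"
  by (rule finite_subset[OF _ finite_arcs]; auto simp: long_arcs_def middle_arcs_def short_spans_def pierced_def)+

lemma arc_in_class:
  assumes "x \<in> arcs"
  obtains c where "fst x + 2 ^ c \<le> snd x" "snd x < fst x + 2 ^ (c + 1)"
proof -
  obtain i where "x \<in> arc_class i" using assms unfolding arcs_eq_UN_class by blast
  then show ?thesis using that[of i] by (auto simp: arc_class_def)
qed

text \<open>Since \<open>horizon i \<le> 2 ^ (i + s)\<close>, an arc of class \<open>c\<close>
  qualifies only for the at most \<open>s\<close> indices in \<open>{c - s..<c}\<close>.\<close>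

lemma sum_long_arcs: "(\<Sum>i<M. card (long_arcs i)) \<le> s * N"
proof -
  have "(\<Sum>i<M. card (long_arcs i)) \<le> s * card arcs"
    unfolding long_arcs_def
  proof (rule sum_card_le_multiplicity[OF finite_arcs])
    fix x assume "x \<in> arcs"
    then obtain c where c: "fst x + 2 ^ c \<le> snd x" "snd x < fst x + 2 ^ (c + 1)" by (rule arc_in_class)
    have "{i \<in> {..<M}. fst x + 2 ^ (i + 1) \<le> snd x \<and> snd x < fst x + 2 * horizon i} \<subseteq> {c - s..<c}"
    proof
      fix i assume "i \<in> {i \<in> {..<M}. fst x + 2 ^ (i + 1) \<le> snd x \<and> snd x < fst x + 2 * horizon i}"
      then have i: "fst x + 2 ^ (i + 1) \<le> snd x" "snd x < fst x + 2 * horizon i" by auto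
      have "(2::nat) ^ (i + 1) < 2 ^ (c + 1)" using i(1) c(2) by linarith
      then have "i < c" by simp
      moreover have "(2::nat) ^ c < 2 ^ (i + s + 1)" using i(2) c(1) horizon_le[of i]
        by (simp only: power_add power_one_right)
      then have "c < i + s + 1" by (rule less_of_power2_less)
      ultimately show "i \<in> {c - s..<c}" by auto
    qed
    then have "card {i \<in> {..<M}. fst x + 2 ^ (i + 1) \<le> snd x \<and> snd x < fst x + 2 * horizon i} \<le> card {c - s..<c}"
      by (intro card_mono) auto
    then show "card {i \<in> {..<M}. fst x + 2 ^ (i + 1) \<le> snd x \<and> snd x < fst x + 2 * horizon i} \<le> s" by simp
  qed simp
  then show ?thesis using card_arcs_le by (meson le_trans mult_le_mono2)
qed

lemma sum_middle_arcs: "(\<Sum>i<M. card (middle_arcs i)) \<le> 4 * s * N"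
proof -
  have "(\<Sum>i<M. card (middle_arcs i)) \<le> (s + 3) * card arcs"
    unfolding middle_arcs_def
  proof (rule sum_card_le_multiplicity[OF finite_arcs])
    fix x assume "x \<in> arcs"
    then obtain c where c: "fst x + 2 ^ c \<le> snd x" "snd x < fst x + 2 ^ (c + 1)" by (rule arc_in_class)
    have "{i \<in> {..<M}. fst x + 2 ^ (i - s - 1) < snd x \<and> snd x < fst x + 2 ^ (i + 2)} \<subseteq> {c - 1..<c + s + 2}"
    proof
      fix i assume "i \<in> {i \<in> {..<M}. fst x + 2 ^ (i - s - 1) < snd x \<and> snd x < fst x + 2 ^ (i + 2)}"
      then have i: "fst x + 2 ^ (i - s - 1) < snd x" "snd x < fst x + 2 ^ (i + 2)" by auto
      have "(2::nat) ^ (i - s - 1) < 2 ^ (c + 1)" using i(1) c(2) by linarith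
      then have "i - s - 1 < c + 1" by (rule less_of_power2_less)
      moreover have "(2::nat) ^ c < 2 ^ (i + 2)" using i(2) c(1) by linarith
      then have "c < i + 2" by (rule less_of_power2_less)
      ultimately show "i \<in> {c - 1..<c + s + 2}" by auto
    qed
    then have "card {i \<in> {..<M}. fst x + 2 ^ (i - s - 1) < snd x \<and> snd x < fst x + 2 ^ (i + 2)} \<le> card {c - 1..<c + s + 2}"
      by (intro card_mono) auto
    then show "card {i \<in> {..<M}. fst x + 2 ^ (i - s - 1) < snd x \<and> snd x < fst x + 2 ^ (i + 2)} \<le> s + 3"
      by simp
  qed simp
  also have "\<dots> \<le> (4 * s) * N" using s_pos card_arcs_le by (intro mult_le_mono) auto
  finally show ?thesis .
qed

lemma card_short_spans: "12 * s * card (short_spans i) \<le> N"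
proof (cases "s < i")
  case True
  then have "(2::nat) ^ (i - s) = 2 * 2 ^ (i - s - 1)"
    by (metis Suc_diff_Suc diff_Suc_1' diff_diff_left plus_1_eq_Suc add.commute power_Suc)
  then show ?thesis unfolding short_spans_def using card_pierced[of "2 ^ (i - s - 1)"] by simp
next
  case False
  \<comment> \<open>Here both powers are 1, and an arc of length 1 has no flip inside.\<close>
  then have "short_spans i = {}" by (auto simp: short_spans_def pierced_def)
  then show ?thesis by simp
qed

text \<open>A flip that is not isolated is an end of an arc shorter than
  \<open>2 * horizon i\<close>. If the arc is shorter than \<open>d i\<close>, its variable recurs
  in the window enlarged by one block on either side; otherwise it is a long arc with its first or
  its second end in the window.\<close>

lemma card_exposed:
  defines "d i \<equiv> 2 ^ (i + 1)"
  shows "card (exposed i k) \<le> card (recurring (k * d i - d i) (min N ((k + 4) * d i - d i))) +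
    card {x \<in> long_arcs i. k * d i \<le> fst x \<and> fst x < (k + 2) * d i} +
    card {x \<in> long_arcs i. k * d i \<le> snd x \<and> snd x < (k + 2) * d i}"
proof -
  let ?A = "recurring (k * d i - d i) (min N ((k + 4) * d i - d i))"
  let ?F = "{x \<in> long_arcs i. k * d i \<le> fst x \<and> fst x < (k + 2) * d i}"
  let ?S = "{x \<in> long_arcs i. k * d i \<le> snd x \<and> snd x < (k + 2) * d i}"
  have "exposed i k \<subseteq> (?A \<union> (v \<circ> fst) ` ?F) \<union> (v \<circ> snd) ` ?S"
  proof
    fix u assume "u \<in> exposed i k"
    then obtain r where r: "u = v r" "k * d i \<le> r" "r < N" "r < (k + 2) * d i" "\<not> isolated (2 * horizon i) r"
      by (auto simp: exposed_def d_def)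
    then obtain r' where r': "r' < N" "v r' = v r" "r' \<noteq> r" "r < r' + 2 * horizon i" "r' < r + 2 * horizon i"
      by (auto simp: isolated_def not_le)
    have D: "(k + 4) * d i - d i = k * d i + 3 * d i" "(k + 2) * d i = k * d i + 2 * d i"
      by (simp_all add: algebra_simps)
    show "u \<in> (?A \<union> (v \<circ> fst) ` ?F) \<union> (v \<circ> snd) ` ?S"
    proof (cases "r < r'")
      case True
      then obtain t where t: "(r, t) \<in> arcs" "t \<le> r'" using next_arc r' by metis
      show ?thesis
      proof (cases "t < r + d i")
        case True
        have "v r \<in> ?A"
        proof (rule recurringI[where t' = t])
          show "k * d i - d i \<le> r" using r by simp
          show "r < t" "v t = v r" using t by (auto simp: arcs_def)
          have "t < N" using t by (auto simp: arcs_def)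
          then show "t < min N ((k + 4) * d i - d i)" unfolding D using True r(4) D(2) by simp
        qed
        then show ?thesis using r by simp
      next
        case False
        then have "(r, t) \<in> ?F" using t r r' by (auto simp: long_arcs_def d_def)
        then show ?thesis using r(1) by force
      qed
    next
      case False
      then have "r' < r" using r' by simp
      then obtain t where t: "(t, r) \<in> arcs" "r' \<le> t" using previous_arc r' r(3) by metis
      have vt: "v t = v r" "t < r" using t by (auto simp: arcs_def)
      show ?thesis
      proof (cases "r < t + d i")
        case True
        have "v t \<in> ?A"
        proof (rule recurringI[where t' = r])
          show "k * d i - d i \<le> t" using r True by simp
          show "t < r" "v r = v t" using vt by auto
          show "r < min N ((k + 4) * d i - d i)" unfolding D using r(3,4) D(2) by simp
        qed
        then show ?thesis using r vt by simp
      next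
        case False
        then have "(t, r) \<in> ?S" using t r r' by (auto simp: long_arcs_def d_def)
        then show ?thesis using r(1) by force
      qed
    qed
  qed
  moreover have "finite ((?A \<union> (v \<circ> fst) ` ?F) \<union> (v \<circ> snd) ` ?S)"
    by (simp add: finite_recurring finite_arc_families)
  ultimately have "card (exposed i k) \<le> card ((?A \<union> (v \<circ> fst) ` ?F) \<union> (v \<circ> snd) ` ?S)"
    by (intro card_mono)
  also have "\<dots> \<le> card ?A + card ((v \<circ> fst) ` ?F) + card ((v \<circ> snd) ` ?S)"
    by (meson add_le_mono card_Un_le le_refl le_trans)
  also have "\<dots> \<le> card ?A + card ?F + card ?S"
    by (intro add_mono card_image_le) (auto simp: finite_arc_families)
  finally show ?thesis .
qed

lemma card_spans:
  defines "d i \<equiv> 2 ^ (i + 1)"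
  shows "card (spans i k) \<le> card {x \<in> short_spans i. k * d i \<le> fst x \<and> fst x < (k + 2) * d i} +
    card {x \<in> middle_arcs i. k * d i \<le> fst x \<and> fst x < (k + 2) * d i}"
proof -
  let ?F = "{x \<in> short_spans i. k * d i \<le> fst x \<and> fst x < (k + 2) * d i}"
  let ?S = "{x \<in> middle_arcs i. k * d i \<le> fst x \<and> fst x < (k + 2) * d i}"
  have "spans i k \<subseteq> ?F \<union> ?S"
  proof
    fix x assume x: "x \<in> spans i k"
    then obtain t t' where tt: "x = (t, t')" "(t, t') \<in> arcs" "k * d i \<le> t" "t' < (k + 2) * d i"
      "\<exists>m. t < m \<and> m < t' \<and> adj (v t) (v m) \<and> isolated (2 ^ (i - s)) m"
      by (auto simp: spans_def d_def)
    have "t < t'" using tt(2) by (auto simp: arcs_def)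
    have "(k + 2) * d i = k * d i + 2 ^ (i + 2)" by (simp add: algebra_simps d_def)
    then have "t' < t + 2 ^ (i + 2)" using tt(3,4) by linarith
    then show "x \<in> ?F \<union> ?S"
      using tt \<open>t < t'\<close> by (auto simp: short_spans_def middle_arcs_def pierced_def)
  qed
  then have "card (spans i k) \<le> card (?F \<union> ?S)"
    by (intro card_mono) (auto simp: finite_arc_families)
  then show ?thesis using card_Un_le[of ?F ?S] by linarith
qed

text \<open>Exposed variables count twice, for the initial value and for the last flip in the
  window. After multiplication by \<open>24 * s\<close>, each class contributes \<open>8 * N\<close>
  from recurrence in four blocks and \<open>4 * N\<close> from short spans. Over
  \<open>s * s\<close> classes these, the long and the middle arcs give
  \<open>12 + 192 + 192 = 12 * 33\<close> times \<open>s * s * N\<close>.\<close>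

lemma sum_block_cost:
  "2 * (\<Sum>i<s * s. \<Sum>k<N. 2 * card (exposed i k) + card (spans i k)) \<le> 33 * s * N"
proof -
  have inner: "24 * s * (\<Sum>k<N. 2 * card (exposed i k) + card (spans i k)) \<le>
      12 * N + 192 * s * card (long_arcs i) + 48 * s * card (middle_arcs i)" for i
  proof -
    let ?d = "2 ^ (i + 1) :: nat"
    define R where "R k = card (recurring (k * ?d - ?d) (min N ((k + 4) * ?d - ?d)))" for k
    define L1 where "L1 k = card {x \<in> long_arcs i. k * ?d \<le> fst x \<and> fst x < (k + 2) * ?d}" for k
    define L2 where "L2 k = card {x \<in> long_arcs i. k * ?d \<le> snd x \<and> snd x < (k + 2) * ?d}" for k
    define Y where "Y k = card {x \<in> short_spans i. k * ?d \<le> fst x \<and> fst x < (k + 2) * ?d}" for k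
    define Z where "Z k = card {x \<in> middle_arcs i. k * ?d \<le> fst x \<and> fst x < (k + 2) * ?d}" for k
    have d: "?d > 0" by simp
    have "(\<Sum>k<N. 2 * card (exposed i k) + card (spans i k)) \<le>
        (\<Sum>k<N. 2 * (R k + L1 k + L2 k) + (Y k + Z k))"
      unfolding R_def L1_def L2_def Y_def Z_def
      by (intro sum_mono add_mono mult_le_mono2 card_exposed card_spans)
    also have "\<dots> = 2 * sum R {..<N} + 2 * sum L1 {..<N} + 2 * sum L2 {..<N} + sum Y {..<N} + sum Z {..<N}"
      by (simp add: sum.distrib sum_distrib_left)
    also have "\<dots> \<le> 2 * sum R {..<N} + 8 * card (long_arcs i) + 2 * card (short_spans i) + 2 * card (middle_arcs i)"
    proof -
      have "sum L1 {..<N} \<le> 2 * card (long_arcs i)" "sum L2 {..<N} \<le> 2 * card (long_arcs i)"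
        "sum Y {..<N} \<le> 2 * card (short_spans i)" "sum Z {..<N} \<le> 2 * card (middle_arcs i)"
        unfolding L1_def L2_def Y_def Z_def by (intro sum_card_windows finite_arc_families d)+
      then show ?thesis by linarith
    qed
    finally have "24 * s * (\<Sum>k<N. 2 * card (exposed i k) + card (spans i k)) \<le>
      24 * s * (2 * sum R {..<N} + 8 * card (long_arcs i) + 2 * card (short_spans i) + 2 * card (middle_arcs i))"
      by (rule mult_le_mono2)
    moreover have "24 * s * sum R {..<N} \<le> 4 * N" unfolding R_def by (rule sum_recurring[OF d])
    ultimately show ?thesis using card_short_spans[of i] by (simp add: algebra_simps)
  qed
  have "24 * s * (\<Sum>i<s * s. \<Sum>k<N. 2 * card (exposed i k) + card (spans i k)) =
      (\<Sum>i<s * s. 24 * s * (\<Sum>k<N. 2 * card (exposed i k) + card (spans i k)))"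
    by (simp only: sum_distrib_left)
  also have "\<dots> \<le> (\<Sum>i<s * s. 12 * N + 192 * s * card (long_arcs i) + 48 * s * card (middle_arcs i))"
    by (intro sum_mono inner)
  also have "\<dots> = 12 * N * (s * s) + 192 * s * (\<Sum>i<s * s. card (long_arcs i)) +
      48 * s * (\<Sum>i<s * s. card (middle_arcs i))"
    by (simp add: sum.distrib sum_distrib_left)
  also have "\<dots> \<le> 12 * N * (s * s) + 192 * s * (s * N) + 48 * s * (4 * s * N)"
    by (intro add_mono mult_le_mono2 sum_long_arcs sum_middle_arcs le_refl)
  also have "\<dots> = 12 * s * (33 * s * N)" by (simp add: algebra_simps)
  finally have "12 * s * (2 * (\<Sum>i<s * s. \<Sum>k<N. 2 * card (exposed i k) + card (spans i k))) \<le> 12 * s * (33 * s * N)"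
    by simp
  then show ?thesis using s_pos by (subst (asm) mult_le_cancel1) simp
qed

definition block :: "nat \<Rightarrow> nat \<Rightarrow> (nat \<times> nat) set" where
  "block i k = {x \<in> good i. fst x div 2 ^ (i + 1) = k}"

text \<open>Averaging over the classes and then over the positions. The factor 66 is
  \<open>33 / 2\<close> from \<open>sum_block_cost\<close> times 4 from
  \<open>sum_good\<close>.\<close>

lemma cheap_block:
  assumes "N > 0"
  obtains i k where "block i k \<noteq> {}"
    "2 * card (exposed i k) + card (spans i k) \<le> 66 * s * card (block i k)"
proof -
  let ?c = "\<lambda>i k. 2 * card (exposed i k) + card (spans i k)"
  have blocks: "(\<Sum>k<N. card (block i k)) = card (good i)" for i
  proof -
    have "(\<Sum>k<N. card (block i k)) = card (\<Union>k<N. block i k)"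
      using finite_good by (intro card_UN_disjoint[symmetric]) (auto simp: block_def)
    also have "(\<Union>k<N. block i k) = good i"
    proof -
      have "fst x div 2 ^ (i + 1) < N" if "x \<in> good i" for x
      proof -
        have "fst x < N" using that by (auto simp: good_def arc_class_def arcs_def)
        then show ?thesis by (rule le_less_trans[OF div_le_dividend])
      qed
      then show ?thesis by (auto simp: block_def)
    qed
    finally show ?thesis .
  qed
  define f where "f i = (\<Sum>k<N. ?c i k)" for i
  define g where "g i = 66 * s * card (good i)" for i
  have sum_g: "sum g {..<s * s} = 66 * s * (\<Sum>i<s * s. card (good i))"
    by (simp add: g_def sum_distrib_left)
  have "2 * sum f {..<s * s} \<le> 33 * s * N" unfolding f_def by (rule sum_block_cost)
  moreover have "33 * s * N \<le> 33 * s * (4 * (\<Sum>i<s * s. card (good i)))" by (rule mult_le_mono2[OF sum_good])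
  ultimately have "sum f {..<s * s} \<le> sum g {..<s * s}" unfolding sum_g by linarith
  moreover have "sum g {..<s * s} > 0" unfolding sum_g using sum_good assms s_pos by simp
  ultimately obtain i where i: "f i \<le> g i" "g i > 0"
    using exists_le_of_sum_le[of "{..<s * s}" f g] by blast
  define h where "h k = 66 * s * card (block i k)" for k
  have "sum h {..<N} = g i" by (simp add: h_def g_def blocks sum_distrib_left[symmetric])
  then have "sum (?c i) {..<N} \<le> sum h {..<N}" "sum h {..<N} > 0" using i by (simp_all add: f_def)
  then obtain k where "?c i k \<le> h k" "h k > 0"
    using exists_le_of_sum_le[of "{..<N}" "?c i" h] by blast
  moreover from this have "block i k \<noteq> {}" by (auto simp: h_def)
  ultimately show ?thesis using that[of i k] by (simp add: h_def)
qed

end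

subsection \<open>Cheaply described independent arcs\<close>

context move_sequence
begin

text \<open>The parity decides whether \<open>u\<close> has different values at the two ends of an
  arc of another variable.\<close>

definition changed :: "nat \<Rightarrow> nat \<Rightarrow> nat \<Rightarrow> bool" where
  "changed t t' u \<longleftrightarrow> odd (card {r. t < r \<and> r < t' \<and> v r = u})"

text \<open>
  The flips whose outcome is still current when a variable that interacts with the flipped one is
  flipped at a time in \<open>M\<close>. These are the only flips that have to be recorded.
\<close>

definition relays :: "nat \<Rightarrow> nat \<Rightarrow> nat set \<Rightarrow> nat set \<Rightarrow> nat set" where
  "relays p q M U = {r. p \<le> r \<and> r < q \<and> v r \<in> U \<and>
     (\<exists>t\<in>M. r < t \<and> adj (v r) (v t) \<and> (\<forall>x. r < x \<and> x < t \<longrightarrow> v x \<noteq> v r))}"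

text \<open>The interaction between \<open>v (fst x)\<close> and \<open>w x\<close> is a private
  coordinate: the gain of another arc contains it only if that arc belongs to one of the two
  variables and the other one changes.\<close>

definition separated :: "(nat \<times> nat) set \<Rightarrow> bool" where
  "separated fam \<longleftrightarrow> (\<exists>w. \<forall>x\<in>fam. adj (v (fst x)) (w x) \<and> changed (fst x) (snd x) (w x) \<and>
     (\<forall>y\<in>fam. y \<noteq> x \<longrightarrow>
        \<not> (v (fst y) = v (fst x) \<and> changed (fst y) (snd y) (w x)) \<and>
        \<not> (v (fst y) = w x \<and> changed (fst y) (snd y) (v (fst x)))))"

definition certificate :: "nat \<Rightarrow> nat \<Rightarrow> (nat \<times> nat) set \<Rightarrow> nat set \<Rightarrow> bool" where
  "certificate p q fam U \<longleftrightarrow> q \<le> N \<and> fam \<noteq> {} \<and> fam \<subseteq> arcs \<and> U \<subseteq> v ` {p..<q} \<and> separated fam \<and>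
     (\<forall>x\<in>fam. p \<le> fst x \<and> snd x < q \<and>
        (\<forall>r. fst x < r \<and> r < snd x \<and> adj (v (fst x)) (v r) \<longrightarrow> v r \<in> U))"

lemma changedD: "changed t t' u \<Longrightarrow> \<exists>r. t < r \<and> r < t' \<and> v r = u"
  unfolding changed_def by (metis (mono_tags, lifting) card.empty empty_Collect_eq even_zero)

end

locale live_sequence = move_sequence +
  assumes adj_sym: "adj a b \<Longrightarrow> adj b a" and adj_irrefl: "\<not> adj a a"
    and live: "x \<in> arcs \<Longrightarrow> \<exists>u. adj (v (fst x)) u \<and> changed (fst x) (snd x) u"
begin

text \<open>One arc is kept per variable \<open>u\<close>, with a changed interacting variable
  \<open>f u\<close> as witness. On an independent set of \<open>f\<close> no other kept arc belongs
  to \<open>u\<close> or to \<open>f u\<close>, which excludes both ways of sharing a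
  coordinate.\<close>

lemma separated_third:
  assumes "finite A" "A \<subseteq> arcs"
  obtains fam where "fam \<subseteq> A" "card (v ` fst ` A) \<le> 3 * card fam" "separated fam"
proof -
  let ?V = "v ` fst ` A"
  have "\<forall>u\<in>?V. \<exists>x\<in>A. v (fst x) = u" by auto
  then obtain a where a: "\<And>u. u \<in> ?V \<Longrightarrow> a u \<in> A \<and> v (fst (a u)) = u" by metis
  have "\<forall>u\<in>?V. \<exists>y. adj u y \<and> changed (fst (a u)) (snd (a u)) y"
    using a live assms(2) by (metis subsetD)
  then obtain f where f: "\<And>u. u \<in> ?V \<Longrightarrow> adj u (f u) \<and> changed (fst (a u)) (snd (a u)) (f u)" by metis
  have "finite ?V" using assms(1) by simp
  moreover have "f u \<noteq> u" if "u \<in> ?V" for u using f[OF that] adj_irrefl by metis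
  ultimately obtain I where I: "I \<subseteq> ?V" "card ?V \<le> 3 * card I" "\<And>x. x \<in> I \<Longrightarrow> f x \<notin> I"
    by (rule exists_independent_third[of ?V f]) auto
  have va: "v (fst (a u)) = u" if "u \<in> I" for u using a I(1) that by blast
  have "inj_on a I" by (metis inj_onI va)
  then have "card (a ` I) = card I" by (rule card_image)
  moreover have "separated (a ` I)"
    unfolding separated_def
  proof (intro exI[of _ "\<lambda>x. f (v (fst x))"] ballI)
    fix x assume "x \<in> a ` I"
    then obtain u where u: "u \<in> I" "x = a u" by blast
    have "v (fst y) \<noteq> u \<and> v (fst y) \<noteq> f u" if "y \<in> a ` I" "y \<noteq> x" for y
    proof -
      obtain u' where "u' \<in> I" "y = a u'" using \<open>y \<in> a ` I\<close> by blast
      then show ?thesis using I(3)[OF u(1)] u that(2) va by metis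
    qed
    then show "adj (v (fst x)) (f (v (fst x))) \<and> changed (fst x) (snd x) (f (v (fst x))) \<and>
        (\<forall>y\<in>a ` I. y \<noteq> x \<longrightarrow>
           \<not> (v (fst y) = v (fst x) \<and> changed (fst y) (snd y) (f (v (fst x)))) \<and>
           \<not> (v (fst y) = f (v (fst x)) \<and> changed (fst y) (snd y) (v (fst x))))"
      using f[OF subsetD[OF I(1) u(1)]] u va[OF u(1)] by auto
  qed
  moreover have "a ` I \<subseteq> A" using a I(1) by blast
  ultimately show ?thesis using that I(2) by metis
qed

text \<open>The witness is the variable flipped only once in the window, so it changes across the
  arc. Arcs of one variable do not overlap, so no second arc of that variable contains this flip;
  and the witness itself has no arc in the window.\<close>

lemma separated_crossed: "separated (crossed p q)"
proof -
  have "\<forall>x\<in>crossed p q. \<exists>r. fst x < r \<and> r < snd x \<and> adj (v (fst x)) (v r) \<and>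
      (\<forall>r'. p \<le> r' \<and> r' < q \<and> v r' = v r \<longrightarrow> r' = r)"
    by (auto simp: crossed_def)
  then obtain f where f: "\<And>x. x \<in> crossed p q \<Longrightarrow> fst x < f x \<and> f x < snd x \<and> adj (v (fst x)) (v (f x))"
      "\<And>x r. x \<in> crossed p q \<Longrightarrow> p \<le> r \<Longrightarrow> r < q \<Longrightarrow> v r = v (f x) \<Longrightarrow> r = f x"
    by metis
  have inside: "p \<le> fst x \<and> snd x < q \<and> x \<in> arcs" if "x \<in> crossed p q" for x
    using that by (auto simp: crossed_def)
  show ?thesis
    unfolding separated_def
  proof (intro exI[of _ "\<lambda>x. v (f x)"] ballI conjI impI)
    fix x assume x: "x \<in> crossed p q"
    show "adj (v (fst x)) (v (f x))" using f(1)[OF x] by simp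
    have "{r. fst x < r \<and> r < snd x \<and> v r = v (f x)} = {f x}"
      using f(1)[OF x] f(2)[OF x] inside[OF x] by force
    then show "changed (fst x) (snd x) (v (f x))" by (simp add: changed_def)
    fix y assume y: "y \<in> crossed p q" "y \<noteq> x"
    have ya: "y \<in> arcs" "fst y < snd y" "v (snd y) = v (fst y)" using inside[OF y(1)] by (auto simp: arcs_def)
    have xa: "x \<in> arcs" using inside[OF x] by simp
    show "\<not> (v (fst y) = v (fst x) \<and> changed (fst y) (snd y) (v (f x)))"
    proof
      assume A: "v (fst y) = v (fst x) \<and> changed (fst y) (snd y) (v (f x))"
      then obtain r where r: "fst y < r" "r < snd y" "v r = v (f x)" using changedD by blast
      have "r = f x" using f(2)[OF x, of r] r inside[OF y(1)] by auto
      then have "fst y < f x" "f x < snd y" "fst x < f x" "f x < snd x" using r f(1)[OF x] by auto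
      moreover have "fst x \<noteq> fst y" using arc_unique_fst xa ya(1) y(2) by (metis prod.collapse)
      ultimately have "(fst x < fst y \<and> fst y < snd x) \<or> (fst y < fst x \<and> fst x < snd y)" by linarith
      then show False using A xa ya(1) unfolding arcs_def by (auto simp: case_prod_beta)
    qed
    show "\<not> (v (fst y) = v (f x) \<and> changed (fst y) (snd y) (v (fst x)))"
    proof
      assume "v (fst y) = v (f x) \<and> changed (fst y) (snd y) (v (fst x))"
      then have "fst y = f x" "snd y = f x"
        using f(2)[OF x, of "fst y"] f(2)[OF x, of "snd y"] inside[OF y(1)] ya by auto
      then show False using ya by simp
    qed
  qed
qed

lemma certificate_full_window:
  assumes "p < q" "q \<le> N" "fam \<subseteq> arcs" "fam \<noteq> {}" "\<And>x. x \<in> fam \<Longrightarrow> p \<le> fst x \<and> snd x < q" "separated fam"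
  shows "certificate p q fam (v ` {p..<q})"
    and "card (v ` {p..<q}) + card (relays p q M (v ` {p..<q})) \<le> 2 * (q - p)"
proof -
  show "certificate p q fam (v ` {p..<q})"
    unfolding certificate_def using assms by (auto 4 3 dest: assms(5))
  have "card (v ` {p..<q}) \<le> card {p..<q}" by (rule card_image_le) simp
  moreover have "card (relays p q M (v ` {p..<q})) \<le> card {p..<q}"
    by (rule card_mono) (auto simp: relays_def)
  ultimately show "card (v ` {p..<q}) + card (relays p q M (v ` {p..<q})) \<le> 2 * (q - p)" by simp
qed

lemma certificate_sparse:
  assumes "sparse_sequence N v adj s" "N > 0"
  obtains p q fam U where "certificate p q fam U"
    "card U + card (relays p q (fst ` fam \<union> snd ` fam) U) \<le> 400 * s * card fam"
proof -
  interpret sparse_sequence N v adj s by fact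
  obtain i k where ik: "block i k \<noteq> {}"
    "2 * card (exposed i k) + card (spans i k) \<le> 66 * s * card (block i k)"
    using cheap_block[OF assms(2)] by blast
  define d :: nat where "d = 2 ^ (i + 1)"
  define p where "p = k * d"
  define q where "q = min N ((k + 2) * d)"
  define U where "U = exposed i k"
  let ?B = "block i k"
  have finB: "finite ?B" using finite_good by (auto simp: block_def)
  have good: "x \<in> good i" if "x \<in> ?B" for x using that by (auto simp: block_def)
  have Barcs: "?B \<subseteq> arcs" using good by (auto simp: good_def arc_class_def)
  have inside: "p \<le> fst x \<and> snd x < q" if "x \<in> ?B" for x
  proof -
    have "fst x div d = k" using that by (simp add: block_def d_def)
    then have "k * d \<le> fst x" "fst x < k * d + d" using div_block[of d "fst x"] by (auto simp: d_def)
    moreover have "snd x < fst x + d" "snd x < N"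
      using good[OF that] by (auto simp: good_def arc_class_def arcs_def d_def)
    ultimately show ?thesis by (simp add: p_def q_def algebra_simps)
  qed
  obtain fam where fam: "fam \<subseteq> ?B" "card (v ` fst ` ?B) \<le> 3 * card fam" "separated fam"
    by (rule separated_third[OF finB Barcs])
  \<comment> \<open>The starts lie in one block of length \<open>2 ^ (i + 1)\<close> and the arcs
    have length at least \<open>2 ^ i\<close>, so a variable has at most two of them.\<close>
  have few: "card ?B \<le> 2 * card (v ` fst ` ?B)"
  proof -
    have "inj_on (\<lambda>x. (v (fst x), fst x div 2 ^ i)) ?B"
    proof (rule inj_onI)
      fix x y assume xy: "x \<in> ?B" "y \<in> ?B" "(v (fst x), fst x div 2 ^ i) = (v (fst y), fst y div 2 ^ i)"
      have "\<not> fst a < fst b" if "a \<in> ?B" "b \<in> ?B" "v (fst a) = v (fst b)" "fst a div 2 ^ i = fst b div 2 ^ i" for a b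
      proof
        assume "fst a < fst b"
        then have "snd a \<le> fst b" using good[OF that(1)] that(3)
          by (auto simp: good_def arc_class_def arcs_def leI)
        moreover have "fst a + 2 ^ i \<le> snd a" using good[OF that(1)] by (auto simp: good_def arc_class_def)
        ultimately have "(fst a + 2 ^ i) div 2 ^ i \<le> fst b div 2 ^ i" by (intro div_le_mono) simp
        moreover have "(fst a + 2 ^ i) div 2 ^ i = fst a div 2 ^ i + 1" by (simp add: div_add_self2)
        ultimately show False using that(4) by simp
      qed
      from this[of x y] this[of y x] have "fst x = fst y" using xy by auto
      then show "x = y" using xy Barcs arc_unique_fst by (metis prod.collapse subsetD)
    qed
    moreover have "(\<lambda>x. (v (fst x), fst x div 2 ^ i)) ` ?B \<subseteq> (v ` fst ` ?B) \<times> {2 * k, 2 * k + 1}"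
    proof -
      have "fst x div 2 ^ i = 2 * k \<or> fst x div 2 ^ i = 2 * k + 1" if "x \<in> ?B" for x
      proof -
        have "(fst x div 2 ^ i) div 2 = k"
          using that by (simp only: block_def mem_Collect_eq div_mult2_eq[symmetric] power_add power_one_right)
        then show ?thesis by linarith
      qed
      then show ?thesis by auto
    qed
    ultimately have "card ?B \<le> card ((v ` fst ` ?B) \<times> {2 * k, 2 * k + 1})"
      using finB by (intro card_inj_on_le) auto
    then show ?thesis by (simp add: card_cartesian_product)
  qed
  have "fam \<noteq> {}"
    using few fam(2) ik(1) finB by (auto simp: card_eq_0_iff)
  have cert: "certificate p q fam U"
    unfolding certificate_def
  proof (intro conjI ballI allI impI)
    show "q \<le> N" by (simp add: q_def)
    show "U \<subseteq> v ` {p..<q}" by (auto simp: U_def exposed_def p_def q_def d_def)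
    fix x assume "x \<in> fam"
    then have x: "x \<in> ?B" using fam(1) by blast
    show "p \<le> fst x" "snd x < q" using inside[OF x] by auto
    fix r assume r: "fst x < r \<and> r < snd x \<and> adj (v (fst x)) (v r)"
    then have "\<not> isolated (2 * horizon i) r"
      using good[OF x] by (auto simp: good_def pierced_def arc_class_def)
    then show "v r \<in> U" using r inside[OF x] by (auto simp: U_def exposed_def p_def q_def d_def)
  qed (use fam Barcs \<open>fam \<noteq> {}\<close> in auto)
  have finU: "finite U" using cert unfolding certificate_def by (auto intro: finite_subset)
  have "card (relays p q (fst ` fam \<union> snd ` fam) U) \<le> card U + card (spans i k)"
  proof -
    let ?R = "relays p q (fst ` fam \<union> snd ` fam) U"
    \<comment> \<open>Last flips within the window, at most one per variable of \<open>U\<close>.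
      Any other relay starts an arc that crosses an end of a good arc, hence a member of
      \<open>spans\<close>.\<close>
    define L where "L = {r \<in> ?R. \<forall>x. r < x \<and> x < q \<longrightarrow> v x \<noteq> v r}"
    have "inj_on v L"
    proof (rule inj_onI)
      fix x y assume xy: "x \<in> L" "y \<in> L" "v x = v y"
      have "x < q" "y < q" using xy by (auto simp: L_def relays_def)
      then show "x = y" using xy by (auto simp: L_def) (metis linorder_neqE_nat)
    qed
    moreover have "v ` L \<subseteq> U" by (auto simp: L_def relays_def)
    ultimately have L: "card L \<le> card U" using finU by (intro card_inj_on_le)
    have "?R - L \<subseteq> fst ` spans i k"
    proof
      fix r assume r: "r \<in> ?R - L"
      then obtain x where x: "r < x" "x < q" "v x = v r" by (auto simp: L_def)
      obtain m where m: "m \<in> fst ` fam \<union> snd ` fam" "r < m" "adj (v r) (v m)"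
        "\<forall>x. r < x \<and> x < m \<longrightarrow> v x \<noteq> v r" using r by (auto simp: relays_def)
      have "x < N" using x(2) by (simp add: q_def)
      then obtain r' where r': "(r, r') \<in> arcs" "r' \<le> x" using next_arc x by metis
      have "r < r'" "v r' = v r" using r' by (auto simp: arcs_def)
      then have "m < r'" using m(3,4) adj_irrefl by (metis linorder_neqE_nat)
      obtain y where y: "y \<in> ?B" "m = fst y \<or> m = snd y" using m(1) fam(1) by auto
      then have "isolated (2 ^ (i - s)) m"
        using good[OF y(1)] by (cases y) (auto simp: good_def drops_def)
      moreover have "k * 2 ^ (i + 1) \<le> r" using r by (auto simp: relays_def p_def d_def)
      moreover have "r' < (k + 2) * 2 ^ (i + 1)" using r'(2) x(2) by (auto simp: q_def d_def)
      ultimately have "(r, r') \<in> spans i k"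
        using r'(1) m(2,3) \<open>m < r'\<close> unfolding spans_def by blast
      then show "r \<in> fst ` spans i k" by force
    qed
    moreover have "finite (spans i k)" by (rule finite_subset[OF _ finite_arcs]) (auto simp: spans_def)
    ultimately have "card (?R - L) \<le> card (spans i k)"
      by (meson card_image_le card_mono finite_imageI le_trans)
    moreover have "card ?R = card (L \<union> (?R - L))"
      by (rule arg_cong[where f = card]) (auto simp: L_def)
    then have "card ?R \<le> card L + card (?R - L)" using card_Un_le[of L "?R - L"] by simp
    ultimately show ?thesis using L by linarith
  qed
  then have "card U + card (relays p q (fst ` fam \<union> snd ` fam) U) \<le> 66 * s * card ?B"
    using ik(2) by (simp add: U_def)
  \<comment> \<open>The 6 is 2 from \<open>few\<close> times 3 from
    \<open>separated_third\<close>.\<close>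
  also have "\<dots> \<le> 66 * s * (6 * card fam)" using few fam(2) by (intro mult_le_mono2) linarith
  also have "\<dots> \<le> 400 * s * card fam" by simp
  finally show ?thesis using that cert by blast
qed

text \<open>If sparsity fails in some window, recording the whole window at cost at most
  \<open>2 * (q - p)\<close> is affordable: the family then has more than
  \<open>(q - p) / (72 * s)\<close> arcs for \<open>recurring\<close> and more than
  \<open>(q - p) / (24 * s)\<close> for \<open>crossed\<close>.\<close>

theorem certificate_exists:
  assumes "s > 0" "N \<le> 2 ^ (s * s)" "2 * card (v ` {..<N}) \<le> N" "N > 0"
  obtains p q fam U where "certificate p q fam U"
    "card U + card (relays p q (fst ` fam \<union> snd ` fam) U) \<le> 400 * s * card fam"
proof (cases "sparse_sequence N v adj s")
  case True
  then show ?thesis using certificate_sparse assms(4) that by blast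
next
  case False
  then consider p q where "p < q" "q \<le> N" "q - p < 24 * s * card (recurring p q)"
    | p q where "p < q" "q \<le> N" "q - p < 24 * s * card (crossed p q)"
    using assms by (auto simp: sparse_sequence_def not_le)
  then show ?thesis
  proof cases
    case 1
    let ?A = "{x \<in> arcs. p \<le> fst x \<and> snd x < q}"
    have fin: "finite ?A" using finite_arcs by auto
    obtain fam where fam: "fam \<subseteq> ?A" "card (v ` fst ` ?A) \<le> 3 * card fam" "separated fam"
      using separated_third[OF fin] by blast
    have "recurring p q \<subseteq> v ` fst ` ?A"
    proof
      fix u assume "u \<in> recurring p q"
      then obtain t t' where t: "u = v t" "p \<le> t" "t < t'" "t' < q" "v t' = v t" by (auto simp: recurring_def)
      then obtain x where "(t, x) \<in> arcs" "x \<le> t'" using next_arc 1(2) by (metis order.strict_trans2)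
      then have "(t, x) \<in> ?A" using t by auto
      then show "u \<in> v ` fst ` ?A" using t(1) by force
    qed
    then have "card (recurring p q) \<le> 3 * card fam"
      using fam(2) fin by (meson card_mono finite_imageI le_trans)
    then have "24 * s * card (recurring p q) \<le> 24 * s * (3 * card fam)" by (rule mult_le_mono2)
    then have le: "q - p < 72 * s * card fam" using 1(3) by linarith
    then have "fam \<noteq> {}" by auto
    then have "certificate p q fam (v ` {p..<q})"
      by (intro certificate_full_window) (use 1 fam in auto)
    moreover have "card (v ` {p..<q}) + card (relays p q (fst ` fam \<union> snd ` fam) (v ` {p..<q})) \<le> 2 * (q - p)"
      by (rule certificate_full_window(2)) (use 1 fam \<open>fam \<noteq> {}\<close> in auto)
    moreover have "2 * (q - p) \<le> 400 * s * card fam" using le by linarith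
    ultimately show ?thesis using that le_trans by blast
  next
    case 2
    let ?fam = "crossed p q"
    have "?fam \<noteq> {}" using 2(3) by auto
    have sub: "?fam \<subseteq> arcs" "\<And>x. x \<in> ?fam \<Longrightarrow> p \<le> fst x \<and> snd x < q" by (auto simp: crossed_def)
    have "certificate p q ?fam (v ` {p..<q})"
      by (rule certificate_full_window(1)[OF 2(1,2) sub(1) \<open>?fam \<noteq> {}\<close> sub(2) separated_crossed])
    moreover have "card (v ` {p..<q}) + card (relays p q (fst ` ?fam \<union> snd ` ?fam) (v ` {p..<q})) \<le> 2 * (q - p)"
      by (rule certificate_full_window(2)[OF 2(1,2) sub(1) \<open>?fam \<noteq> {}\<close> sub(2) separated_crossed])
    moreover have "2 * (q - p) \<le> 400 * s * card ?fam" using 2(3) by linarith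
    ultimately show ?thesis using that le_trans by blast
  qed
qed

end

subsection \<open>Linear forms with private coordinates\<close>

lemma bounded_density_distD:
  assumes "bounded_density_dist \<phi> D"
  shows "prob_space D" "sets D = sets borel" "AE x in D. x \<in> {-1..1}"
proof -
  show "prob_space D" "AE x in D. x \<in> {-1..1}"
    using assms unfolding bounded_density_dist_def by blast+
  obtain f where "D = density lborel f" using assms unfolding bounded_density_dist_def by blast
  then show "sets D = sets borel" by simp
qed

lemma bounded_density_dist_interval:
  assumes "bounded_density_dist \<phi> D" "c \<ge> 0"
  shows "emeasure D {l..l + c} \<le> ennreal (\<phi> * c)"
proof -
  obtain f where f: "f \<in> borel_measurable borel" "\<And>x. 0 \<le> f x \<and> f x \<le> \<phi>" "D = density lborel (\<lambda>x. ennreal (f x))"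
    using assms(1) by (auto simp: bounded_density_dist_def)
  have "emeasure D {l..l + c} = (\<integral>\<^sup>+ x. ennreal (f x) * indicator {l..l + c} x \<partial>lborel)"
    unfolding f(3) using f(1) by (intro emeasure_density) auto
  also have "\<dots> \<le> (\<integral>\<^sup>+ x. ennreal \<phi> * indicator {l..l + c} x \<partial>lborel)"
    using f(2) by (intro nn_integral_mono mult_right_mono ennreal_leI) auto
  also have "\<dots> = ennreal \<phi> * ennreal c"
    using assms(2) by (simp add: nn_integral_cmult_indicator)
  also have "\<dots> = ennreal (\<phi> * c)"
    using f(2)[of 0] assms(2) by (simp add: ennreal_mult)
  finally show ?thesis .
qed

text \<open>All the mass lies on an interval of length 2. The bound later absorbs an additive
  constant into \<open>\<phi> * real m\<close>.\<close>

lemma bounded_density_dist_ge_half: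
  assumes "bounded_density_dist \<phi> D"
  shows "1 / 2 \<le> \<phi>"
proof -
  interpret prob_space D using assms by (simp add: bounded_density_dist_def)
  have ae: "AE x in D. x \<in> {-1..1}" and sets: "sets D = sets borel"
    using assms by (auto simp: bounded_density_dist_def)
  have "1 = emeasure D {-1..1}"
    using emeasure_eq_1_AE[OF _ ae] sets by simp
  also have "\<dots> \<le> ennreal (\<phi> * 2)"
    using bounded_density_dist_interval[OF assms, of 2 "-1"] by simp
  finally have "1 \<le> ennreal (\<phi> * 2)" .
  then show ?thesis by (simp add: ennreal_le_iff2 flip: ennreal_1 split: if_splits)
qed

lemma affine_interval_subset:
  fixes a b c :: real
  assumes "\<bar>a\<bar> \<ge> 1" "c \<ge> 0"
  obtains l where "{x. 0 < a * x + b \<and> a * x + b \<le> c} \<subseteq> {l..l + c}"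
proof -
  define l where "l = - b / a - (if a > 0 then 0 else c)"
  have "x \<in> {l..l + c}" if x: "0 < a * x + b" "a * x + b \<le> c" for x
  proof -
    define y where "y = (a * x + b) / \<bar>a\<bar>"
    have "0 < y" unfolding y_def using x assms(1) by (intro divide_pos_pos) auto
    moreover have "y \<le> c / 1" unfolding y_def using x assms by (intro frac_le) auto
    moreover have "x = - b / a + sgn a * y"
      unfolding y_def using assms(1) by (cases "a > 0") (auto simp: field_simps)
    ultimately show ?thesis using assms(1) by (auto simp: l_def)
  qed
  then show ?thesis using that by blast
qed

lemma measurable_component_borel:
  assumes "\<And>i. sets (D i) = sets borel" "i \<in> I"
  shows "(\<lambda>w. w i) \<in> borel_measurable (Pi\<^sub>M I D)"
  using measurable_component_singleton[OF assms(2), of D] measurable_cong_sets[OF refl assms(1)] by blast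

text \<open>Integrating out the private coordinate \<open>\<pi> r\<close> of one form \<open>r\<close> first gives the factor \<open>\<phi> * c\<close>.\<close>

lemma emeasure_private_forms_le:
  fixes D :: "'i \<Rightarrow> real measure" and a :: "'r \<Rightarrow> 'i \<Rightarrow> real"
  assumes "finite R" "finite I" "\<And>i. prob_space (D i)" "\<And>i. sets (D i) = sets borel"
    and "\<And>i l. i \<in> I \<Longrightarrow> emeasure (D i) {l..l + c} \<le> ennreal (\<phi> * c)"
    and "c \<ge> 0"
    and "\<And>r. r \<in> R \<Longrightarrow> \<pi> r \<in> I \<and> \<bar>a r (\<pi> r)\<bar> \<ge> 1"
    and "\<And>r r'. r \<in> R \<Longrightarrow> r' \<in> R \<Longrightarrow> r' \<noteq> r \<Longrightarrow> a r' (\<pi> r) = 0"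
  shows "emeasure (Pi\<^sub>M I D) {w \<in> space (Pi\<^sub>M I D). \<forall>r\<in>R. 0 < (\<Sum>i\<in>I. a r i * w i) \<and> (\<Sum>i\<in>I. a r i * w i) \<le> c}
    \<le> ennreal (\<phi> * c) ^ card R"
  using assms(1,2,5,7,8)
proof (induction R arbitrary: I rule: finite_induct)
  case empty
  have "prob_space (Pi\<^sub>M I D)" by (rule prob_space_PiM) (rule assms(3))
  then show ?case using prob_space.emeasure_le_1 by fastforce
next
  case (insert r R)
  have psf: "product_sigma_finite D"
    using assms(3) by (simp add: product_sigma_finite_def prob_space_imp_sigma_finite)
  define p where "p = \<pi> r"
  define J where "J = I - {p}"
  have p: "p \<in> I" "\<bar>a r p\<bar> \<ge> 1" using insert.prems(3)[of r] by (auto simp: p_def)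
  have I: "I = insert p J" "p \<notin> J" "finite J" using p insert.prems(1) by (auto simp: J_def)
  have zero: "a r' p = 0" if "r' \<in> R" for r'
    using insert.prems(4)[of r r'] that insert.hyps(2) by (auto simp: p_def)
  define F where "F r w = (\<Sum>i\<in>I. a r i * w i)" for r and w :: "'i \<Rightarrow> real"
  define S where "S r w = (\<Sum>i\<in>J. a r i * w i)" for r and w :: "'i \<Rightarrow> real"
  define A where "A = {w \<in> space (Pi\<^sub>M I D). \<forall>r\<in>insert r R. 0 < F r w \<and> F r w \<le> c}"
  define B where "B = {w \<in> space (Pi\<^sub>M J D). \<forall>r\<in>R. 0 < S r w \<and> S r w \<le> c}"
  have F[measurable]: "F r \<in> borel_measurable (Pi\<^sub>M I D)" for r
    unfolding F_def
    by (intro borel_measurable_sum borel_measurable_times borel_measurable_const measurable_component_borel assms(4))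
  have S[measurable]: "S r \<in> borel_measurable (Pi\<^sub>M J D)" for r
    unfolding S_def
    by (intro borel_measurable_sum borel_measurable_times borel_measurable_const measurable_component_borel assms(4))
  have A: "A \<in> sets (Pi\<^sub>M I D)" unfolding A_def
  proof (rule sets.sets_Collect_finite_All)
    show "{w \<in> space (Pi\<^sub>M I D). 0 < F r' w \<and> F r' w \<le> c} \<in> sets (Pi\<^sub>M I D)" for r' by measurable
  qed (use insert.hyps in simp)
  have B: "B \<in> sets (Pi\<^sub>M J D)" unfolding B_def
  proof (rule sets.sets_Collect_finite_All)
    show "{w \<in> space (Pi\<^sub>M J D). 0 < S r' w \<and> S r' w \<le> c} \<in> sets (Pi\<^sub>M J D)" for r' by measurable
  qed (use insert.hyps in simp)
  have split: "F r' (w(p := x)) = a r' p * x + S r' w" for r' w x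
  proof -
    have "(\<Sum>i\<in>J. a r' i * (w(p := x)) i) = (\<Sum>i\<in>J. a r' i * w i)"
      using I(2) by (intro sum.cong) auto
    then show ?thesis unfolding F_def S_def I(1) using I(2,3) by simp
  qed
  have inner: "(\<integral>\<^sup>+ x. indicator A (w(p := x)) \<partial>D p) \<le> ennreal (\<phi> * c) * indicator B w"
    if w: "w \<in> space (Pi\<^sub>M J D)" for w
  proof -
    obtain l where l: "{x. 0 < a r p * x + S r w \<and> a r p * x + S r w \<le> c} \<subseteq> {l..l + c}"
      using affine_interval_subset[OF p(2) assms(6)] by blast
    have "indicator A (w(p := x)) \<le> (indicator B w * indicator {l..l + c} x :: ennreal)" for x
    proof (cases "w(p := x) \<in> A")
      case True
      then have *: "\<forall>r'\<in>insert r R. 0 < a r' p * x + S r' w \<and> a r' p * x + S r' w \<le> c"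
        by (simp add: A_def split)
      \<comment> \<open>The other forms do not see the coordinate \<open>p\<close>, so their
        conditions concern \<open>w\<close> alone.\<close>
      then have "w \<in> B" using w zero by (auto simp: B_def)
      moreover have "x \<in> {l..l + c}" using * l by blast
      ultimately show ?thesis using True by simp
    qed simp
    then have "(\<integral>\<^sup>+ x. indicator A (w(p := x)) \<partial>D p) \<le> (\<integral>\<^sup>+ x. indicator B w * indicator {l..l + c} x \<partial>D p)"
      by (rule nn_integral_mono)
    also have "\<dots> = indicator B w * emeasure (D p) {l..l + c}"
      by (rule nn_integral_cmult_indicator) (simp add: assms(4))
    also have "\<dots> \<le> indicator B w * ennreal (\<phi> * c)"
      by (intro mult_left_mono insert.prems(2) p) simp
    finally show ?thesis by (simp add: mult.commute)
  qed
  have "emeasure (Pi\<^sub>M I D) A = (\<integral>\<^sup>+ w. indicator A w \<partial>Pi\<^sub>M I D)"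
    using A by simp
  also have "\<dots> = (\<integral>\<^sup>+ w. (\<integral>\<^sup>+ x. indicator A (w(p := x)) \<partial>D p) \<partial>Pi\<^sub>M J D)"
    unfolding I(1)
    by (rule product_sigma_finite.product_nn_integral_insert[OF psf I(3,2)]) (use A I(1) in simp)
  also have "\<dots> \<le> (\<integral>\<^sup>+ w. ennreal (\<phi> * c) * indicator B w \<partial>Pi\<^sub>M J D)"
    by (rule nn_integral_mono) (rule inner)
  also have "\<dots> = ennreal (\<phi> * c) * emeasure (Pi\<^sub>M J D) B"
    by (rule nn_integral_cmult_indicator[OF B])
  also have "\<dots> \<le> ennreal (\<phi> * c) * ennreal (\<phi> * c) ^ card R"
  proof (intro mult_left_mono)
    have "\<pi> r' \<in> J \<and> 1 \<le> \<bar>a r' (\<pi> r')\<bar>" if "r' \<in> R" for r'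
      using insert.prems(3)[of r'] zero[OF that] that by (auto simp: J_def)
    then show "emeasure (Pi\<^sub>M J D) B \<le> ennreal (\<phi> * c) ^ card R"
      unfolding B_def S_def using insert.prems by (intro insert.IH I(3)) (auto simp: J_def)
  qed simp
  finally show ?case using insert.hyps by (simp add: A_def F_def)
qed

lemma sum_power_card_Pow:
  fixes x :: "'b::comm_semiring_1"
  assumes "finite A"
  shows "(\<Sum>X\<in>Pow A. x ^ card X) = (x + 1) ^ card A"
  using prod_add[OF assms, of "\<lambda>_. x" "\<lambda>_. 1"] by simp

text \<open>Padded with \<open>None\<close>, a subset becomes a list of length exactly
  \<open>q\<close> over \<open>card U + 1\<close> symbols.\<close>

lemma card_bounded_subsets_le:
  assumes "finite U"
  shows "card {W. W \<subseteq> U \<and> card W \<le> q} \<le> (card U + 1) ^ q"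
proof -
  let ?L = "{xs. set xs \<subseteq> insert None (Some ` U) \<and> length xs = q}"
  have fin: "finite ?L" using assms by (intro finite_lists_length_eq) simp
  have "{W. W \<subseteq> U \<and> card W \<le> q} \<subseteq> (\<lambda>xs. {a. Some a \<in> set xs}) ` ?L"
  proof
    fix W assume W: "W \<in> {W. W \<subseteq> U \<and> card W \<le> q}"
    then obtain ys where ys: "set ys = W" "distinct ys"
      using assms finite_distinct_list finite_subset by blast
    then have len: "length ys \<le> q" using W distinct_card by fastforce
    let ?xs = "map Some ys @ replicate (q - length ys) None"
    have "?xs \<in> ?L" using ys W len by auto
    moreover have "{a. Some a \<in> set ?xs} = W" using ys by auto
    ultimately show "W \<in> (\<lambda>xs. {a. Some a \<in> set xs}) ` ?L" by blast
  qed
  then have "card {W. W \<subseteq> U \<and> card W \<le> q} \<le> card ?L"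
    by (rule surj_card_le[OF fin])
  also have "\<dots> = card (insert None (Some ` U)) ^ q"
    using assms by (intro card_lists_length_eq) simp
  also have "card (insert None (Some ` U)) = card U + 1"
    using assms by (simp add: card_image)
  finally show ?thesis .
qed

subsection \<open>Encoding runs with small gains\<close>

text \<open>The mixed second difference. It vanishes exactly when \<open>f\<close> is a sum of two
  functions of one argument each, and such terms cancel over two opposite flips.\<close>

definition interaction :: "(bool \<times> bool \<Rightarrow> nat) \<Rightarrow> real" where
  "interaction f = real (f (True, True)) - real (f (True, False)) - real (f (False, True)) + real (f (False, False))"

definition interacting :: "bfop_function list \<Rightarrow> nat \<Rightarrow> nat \<Rightarrow> bool" where
  "interacting fs a b \<longleftrightarrow> a \<noteq> b \<and>
     (\<exists>i<length fs. fst (fs ! i) \<in> {(a, b), (b, a)} \<and> interaction (snd (fs ! i)) \<noteq> 0)"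

text \<open>
  The coefficient of the weight \<open>w i\<close> in the total gain of two flips of \<open>v\<close>, one in state \<open>\<tau>\<close>,
  where \<open>v\<close> has the value \<open>b\<close>, and one in state \<open>\<tau>'\<close>, where it has the value \<open>\<not> b\<close>: everything
  cancels except the interactions with those variables that differ between the two states.
\<close>

definition pair_coeff ::
    "bfop_function list \<Rightarrow> nat \<Rightarrow> bool \<Rightarrow> assignment \<Rightarrow> assignment \<Rightarrow> nat \<Rightarrow> real" where
  "pair_coeff fs v b \<tau> \<tau>' i =
     (let x = fst (fst (fs ! i)); y = snd (fst (fs ! i));
          c = (if b then - 1 else 1) * interaction (snd (fs ! i)) in
      if x = v \<and> y \<noteq> v then c * (of_bool (\<tau> y) - of_bool (\<tau>' y))
      else if y = v \<and> x \<noteq> v then c * (of_bool (\<tau> x) - of_bool (\<tau>' x))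
      else 0)"

lemma bfop_objective_two_flips:
  assumes "\<tau> v = b" "\<tau>' v = (\<not> b)"
  shows "(bfop_objective fs w (flip v \<tau>) - bfop_objective fs w \<tau>) +
      (bfop_objective fs w (flip v \<tau>') - bfop_objective fs w \<tau>') =
    (\<Sum>i<length fs. pair_coeff fs v b \<tau> \<tau>' i * w i)"
proof -
  have "w i * real (bfop_value (flip v \<tau>) (fs ! i)) - w i * real (bfop_value \<tau> (fs ! i)) +
      (w i * real (bfop_value (flip v \<tau>') (fs ! i)) - w i * real (bfop_value \<tau>' (fs ! i))) =
      pair_coeff fs v b \<tau> \<tau>' i * w i" for i
  proof -
    obtain x y f where f: "fs ! i = ((x, y), f)" by (metis surj_pair)
    show ?thesis
      using assms
      by (cases "x = v"; cases "y = v"; cases b; cases "\<tau> x"; cases "\<tau> y"; cases "\<tau>' x"; cases "\<tau>' y")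
         (simp_all add: f pair_coeff_def bfop_value_def flip_def interaction_def algebra_simps)
  qed
  then show ?thesis
    unfolding bfop_objective_def by (simp add: sum_subtractf[symmetric] sum.distrib[symmetric])
qed

text \<open>Only differences between the two states matter. Hence a variable that is constant in
  between may be decoded wrongly, as long as it is decoded alike at both ends.\<close>

lemma pair_coeff_cong:
  assumes "i < length fs" "\<And>u. interacting fs v u \<Longrightarrow> of_bool (\<tau> u) - of_bool (\<tau>' u) = (of_bool (\<sigma> u) - of_bool (\<sigma>' u) :: real)"
  shows "pair_coeff fs v b \<tau> \<tau>' i = pair_coeff fs v b \<sigma> \<sigma>' i"
proof -
  obtain x y f where f: "fs ! i = ((x, y), f)" by (metis surj_pair)
  show ?thesis
  proof (cases "interaction f = 0")
    case False
    have "interacting fs v y" if "x = v" "y \<noteq> v"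
      using that assms(1) False f by (auto simp: interacting_def intro!: exI[of _ i])
    moreover have "interacting fs v x" if "y = v" "x \<noteq> v"
      using that assms(1) False f by (auto simp: interacting_def intro!: exI[of _ i])
    ultimately have "x = v \<Longrightarrow> y \<noteq> v \<Longrightarrow> (of_bool (\<tau> y) - of_bool (\<tau>' y) :: real) = of_bool (\<sigma> y) - of_bool (\<sigma>' y)"
      "y = v \<Longrightarrow> x \<noteq> v \<Longrightarrow> (of_bool (\<tau> x) - of_bool (\<tau>' x) :: real) = of_bool (\<sigma> x) - of_bool (\<sigma>' x)"
      using assms(2) by blast+
    then show ?thesis by (cases "x = v"; cases "y = v") (simp_all add: pair_coeff_def f Let_def)
  qed (simp add: pair_coeff_def f)
qed

lemma pair_coeff_nonzeroD:
  assumes "pair_coeff fs v b \<tau> \<tau>' i \<noteq> 0" "i < length fs"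
  obtains u where "interacting fs v u" "\<tau> u \<noteq> \<tau>' u" "fst (fs ! i) \<in> {(v, u), (u, v)}"
proof -
  obtain x y f where f: "fs ! i = ((x, y), f)" by (metis surj_pair)
  have "interaction f \<noteq> 0" using assms(1) by (auto simp: pair_coeff_def f Let_def split: if_splits)
  then have *: "interacting fs v u" if "fst (fs ! i) \<in> {(v, u), (u, v)}" "u \<noteq> v" for u
    using that assms(2) f by (auto simp: interacting_def intro!: exI[of _ i])
  show ?thesis
  proof (cases "x = v")
    case True
    then have "y \<noteq> v" "\<tau> y \<noteq> \<tau>' y" using assms(1) by (auto simp: pair_coeff_def f Let_def split: if_splits)
    then show ?thesis using that[of y] *[of y] f True by simp
  next
    case False
    then have "y = v" using assms(1) by (auto simp: pair_coeff_def f Let_def split: if_splits)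
    moreover have "\<tau> x \<noteq> \<tau>' x" using assms(1) False by (auto simp: pair_coeff_def f Let_def split: if_splits)
    ultimately show ?thesis using that[of x] *[of x] f False by simp
  qed
qed

text \<open>The functions have integer values, so a nonzero \<open>interaction\<close> is at least 1
  in absolute value.\<close>

lemma pair_coeff_ge_1:
  assumes "interacting fs v u" "\<tau> u \<noteq> \<tau>' u"
  obtains i where "i < length fs" "fst (fs ! i) \<in> {(v, u), (u, v)}" "\<bar>pair_coeff fs v b \<tau> \<tau>' i\<bar> \<ge> 1"
proof -
  obtain i where i: "v \<noteq> u" "i < length fs" "fst (fs ! i) \<in> {(v, u), (u, v)}" "interaction (snd (fs ! i)) \<noteq> 0"
    using assms(1) by (auto simp: interacting_def)
  let ?f = "snd (fs ! i)"
  let ?k = "int (?f (True, True)) - int (?f (True, False)) - int (?f (False, True)) + int (?f (False, False))"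
  have "interaction ?f = real_of_int ?k" by (simp add: interaction_def)
  moreover from this have "?k \<noteq> 0" using i(4) by (metis of_int_0)
  ultimately have "\<bar>interaction ?f\<bar> \<ge> 1" by (simp flip: of_int_abs)
  moreover have "fst (fs ! i) = (v, u) \<or> fst (fs ! i) = (u, v)" using i(3) by simp
  ultimately have "\<bar>pair_coeff fs v b \<tau> \<tau>' i\<bar> \<ge> 1"
    using i(1) assms(2) by (cases b; cases "\<tau> u") (auto simp: pair_coeff_def)
  then show ?thesis using that i by blast
qed

text \<open>A row consists of the two times of an arc, its variable and the value of this variable
  before the first flip; a write consists of a time, a variable and a value.\<close>

type_synonym row_code = "nat \<times> nat \<times> nat \<times> bool"
type_synonym write_code = "nat \<times> nat \<times> bool"

text \<open>The last write decides; variables that are never written count as \<open>False\<close>.\<close>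

definition decoded_state :: "write_code set \<Rightarrow> nat \<Rightarrow> assignment" where
  "decoded_state W t u \<longleftrightarrow> (\<exists>r\<le>t. (r, u, True) \<in> W \<and> (\<forall>r'\<le>t. \<forall>b. (r', u, b) \<in> W \<longrightarrow> r' \<le> r))"

definition row_coeff :: "bfop_function list \<Rightarrow> write_code set \<Rightarrow> row_code \<Rightarrow> nat \<Rightarrow> real" where
  "row_coeff fs W = (\<lambda>(t, t', v, b). pair_coeff fs v b (decoded_state W t) (decoded_state W t'))"

lemma decoded_state_eq:
  assumes "r \<le> t" "(r, u, b) \<in> W" "(r, u, \<not> b) \<notin> W" "\<And>r' b'. r' \<le> t \<Longrightarrow> (r', u, b') \<in> W \<Longrightarrow> r' \<le> r"
  shows "decoded_state W t u = b"
proof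
  assume "decoded_state W t u"
  then obtain r' where "r' \<le> t" "(r', u, True) \<in> W" "r \<le> r'"
    using assms(1,2) by (auto simp: decoded_state_def)
  then show b using assms(3,4) by (metis le_antisym)
next
  assume b
  then show "decoded_state W t u" using assms by (auto simp: decoded_state_def)
qed

definition private_rows :: "bfop_function list \<Rightarrow> row_code set \<Rightarrow> write_code set \<Rightarrow> bool" where
  "private_rows fs R W \<longleftrightarrow> (\<exists>\<pi>. \<forall>x\<in>R. \<pi> x < length fs \<and> \<bar>row_coeff fs W x (\<pi> x)\<bar> \<ge> 1 \<and>
     (\<forall>y\<in>R. y \<noteq> x \<longrightarrow> row_coeff fs W y (\<pi> x) = 0))"

text \<open>No condition mentions the weights, which is what permits a union bound over this set.
  Write times may equal \<open>2 * n\<close> because the outcome of a flip is dated one step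
  later.\<close>

definition codes :: "bfop_function list \<Rightarrow> nat \<Rightarrow> nat \<Rightarrow> (row_code set \<times> write_code set) set" where
  "codes fs n K = {(R, W). R \<noteq> {} \<and> R \<subseteq> {..<2 * n} \<times> {..<2 * n} \<times> {..<n} \<times> UNIV \<and>
     W \<subseteq> {..2 * n} \<times> {..<n} \<times> UNIV \<and> card W \<le> K * card R \<and> private_rows fs R W}"

primrec states :: "assignment \<Rightarrow> (nat \<Rightarrow> nat) \<Rightarrow> nat \<Rightarrow> assignment" where
  "states \<tau> v 0 = \<tau>"
| "states \<tau> v (Suc t) = flip (v t) (states \<tau> v t)"

lemma states_differ_iff:
  assumes "t \<le> t'"
  shows "states \<tau> v t u \<noteq> states \<tau> v t' u \<longleftrightarrow> odd (card {r. t \<le> r \<and> r < t' \<and> v r = u})"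
  using assms
proof (induction t' rule: dec_induct)
  case base
  have "{r. t \<le> r \<and> r < t \<and> v r = u} = {}" by auto
  then show ?case by (simp only: card.empty) simp
next
  case (step m)
  have fin: "finite {r. t \<le> r \<and> r < m \<and> v r = u}" by simp
  show ?case
  proof (cases "v m = u")
    case True
    then have "{r. t \<le> r \<and> r < Suc m \<and> v r = u} = insert m {r. t \<le> r \<and> r < m \<and> v r = u}"
      using step by (auto simp: less_Suc_eq)
    then show ?thesis using step.IH fin True by (auto simp: flip_def)
  next
    case False
    then have "{r. t \<le> r \<and> r < Suc m \<and> v r = u} = {r. t \<le> r \<and> r < m \<and> v r = u}"
      by (auto simp: less_Suc_eq)
    then show ?thesis using step.IH False by (simp add: flip_def)
  qed
qed

lemma states_eqI:
  assumes "t \<le> t'" "\<And>r. t \<le> r \<Longrightarrow> r < t' \<Longrightarrow> v r \<noteq> u"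
  shows "states \<tau> v t u = states \<tau> v t' u"
proof -
  have "{r. t \<le> r \<and> r < t' \<and> v r = u} = {}" using assms(2) by auto
  then show ?thesis using states_differ_iff[OF assms(1), of \<tau> v u] by (metis card.empty even_zero)
qed

lemma (in move_sequence) changed_iff_states:
  assumes "t < t'" "u \<noteq> v t"
  shows "changed t t' u \<longleftrightarrow> states \<tau> v t u \<noteq> states \<tau> v t' u"
proof -
  have "{r. t \<le> r \<and> r < t' \<and> v r = u} = {r. t < r \<and> r < t' \<and> v r = u}"
    using assms(2) by (auto simp: le_less)
  then show ?thesis using states_differ_iff[of t t' \<tau> v u] assms(1) by (simp add: changed_def)
qed

lemma (in move_sequence) states_arc:
  assumes "(t, t') \<in> arcs"
  shows "states \<tau> v t' (v t) = (\<not> states \<tau> v t (v t))"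
proof -
  have "{r. t \<le> r \<and> r < t' \<and> v r = v t} = {t}" using assms by (auto simp: arcs_def) (metis le_less)
  then show ?thesis using states_differ_iff[of t t' \<tau> v "v t"] assms by (auto simp: arcs_def)
qed

definition gain :: "(assignment \<Rightarrow> real) \<Rightarrow> assignment \<Rightarrow> (nat \<Rightarrow> nat) \<Rightarrow> nat \<Rightarrow> real" where
  "gain obj \<tau> v t = obj (states \<tau> v (Suc t)) - obj (states \<tau> v t)"

lemma improving_run_has_code:
  fixes n s :: nat
  assumes "n > 0" "s > 0" "2 * n \<le> 2 ^ (s * s)"
    and vars: "\<And>t. t < 2 * n \<Longrightarrow> v t < n"
    and gain: "\<And>t. t < 2 * n \<Longrightarrow> 0 < gain (bfop_objective fs w) \<tau> v t \<and> gain (bfop_objective fs w) \<tau> v t \<le> \<epsilon>"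
  obtains R W where "(R, W) \<in> codes fs n (400 * s)"
    "\<And>x. x \<in> R \<Longrightarrow> 0 < (\<Sum>i<length fs. row_coeff fs W x i * w i) \<and> (\<Sum>i<length fs. row_coeff fs W x i * w i) \<le> 2 * \<epsilon>"
proof -
  interpret move_sequence "2 * n" v "interacting fs" .
  let ?st = "states \<tau> v"
  have two: "(\<Sum>i<length fs. pair_coeff fs (v t) (?st t (v t)) (?st t) (?st t') i * w i) = gain (bfop_objective fs w) \<tau> v t + gain (bfop_objective fs w) \<tau> v t'"
    if "(t, t') \<in> arcs" for t t'
  proof -
    have "v t' = v t" using that by (auto simp: arcs_def)
    then show ?thesis
      using bfop_objective_two_flips[of "?st t" "v t" "?st t (v t)" "?st t'" fs w] states_arc[OF that, of \<tau>]
      by (simp add: gain_def)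
  qed
  have arc_lt: "t < t'" "t' < 2 * n" "t < 2 * n" "v t' = v t" if "(t, t') \<in> arcs" for t t'
    using that by (auto simp: arcs_def)
  interpret live_sequence "2 * n" v "interacting fs"
  proof
    show "interacting fs a b \<Longrightarrow> interacting fs b a" for a b by (auto simp: interacting_def)
    show "\<not> interacting fs a a" for a by (simp add: interacting_def)
    fix x assume "x \<in> arcs"
    then obtain t t' where x: "x = (t, t')" "(t, t') \<in> arcs" by (metis surj_pair)
    \<comment> \<open>A positive total gain forces a nonzero coefficient, and with it an interacting
      variable that changed.\<close>
    have "(\<Sum>i<length fs. pair_coeff fs (v t) (?st t (v t)) (?st t) (?st t') i * w i) > 0"
      using two[OF x(2)] gain arc_lt[OF x(2)] by (metis add_pos_pos)
    then obtain i where i: "i < length fs" "pair_coeff fs (v t) (?st t (v t)) (?st t) (?st t') i \<noteq> 0"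
      by (metis (no_types, lifting) lessThan_iff less_irrefl mult_zero_left sum.neutral)
    obtain u where "interacting fs (v t) u" "?st t u \<noteq> ?st t' u"
      by (rule pair_coeff_nonzeroD[OF i(2,1)])
    moreover from this have "u \<noteq> v t" by (auto simp: interacting_def)
    ultimately show "\<exists>u. interacting fs (v (fst x)) u \<and> changed (fst x) (snd x) u"
      using changed_iff_states[of t t' u \<tau>] arc_lt[OF x(2)] x(1) by auto
  qed
  have "v ` {..<2 * n} \<subseteq> {..<n}" using vars by auto
  then have nodes: "card (v ` {..<2 * n}) \<le> n" by (metis card_lessThan card_mono finite_lessThan)
  obtain p q fam U where cert: "certificate p q fam U"
    and cost: "card U + card (relays p q (fst ` fam \<union> snd ` fam) U) \<le> 400 * s * card fam"
    by (rule certificate_exists[of s]) (use nodes \<open>n > 0\<close> \<open>s > 0\<close> \<open>2 * n \<le> 2 ^ (s * s)\<close> in auto)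
  have q: "q \<le> 2 * n" and fam: "fam \<noteq> {}" "fam \<subseteq> arcs" and U: "U \<subseteq> v ` {p..<q}"
    and sep: "separated fam"
    and window: "\<And>t t'. (t, t') \<in> fam \<Longrightarrow> p \<le> t \<and> t' < q"
    and affected: "\<And>t t' r. (t, t') \<in> fam \<Longrightarrow> t < r \<Longrightarrow> r < t' \<Longrightarrow> interacting fs (v t) (v r) \<Longrightarrow> v r \<in> U"
    using cert by (auto simp: certificate_def)
  define M where "M = fst ` fam \<union> snd ` fam"
  \<comment> \<open>The values of \<open>U\<close> at the start of the window and the outcome of
    each relay, dated \<open>Suc r\<close> as it belongs to the state after the flip.\<close>
  define W where "W = (\<lambda>u. (p, u, ?st p u)) ` U \<union> (\<lambda>r. (Suc r, v r, ?st (Suc r) (v r))) ` relays p q M U"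
  define code where "code = (\<lambda>(t, t' :: nat). (t, t', v t, ?st t (v t)))"
  have finU: "finite U" using U finite_subset by blast
  have finrel: "finite (relays p q M U)" by (rule finite_subset[of _ "{..<q}"]) (auto simp: relays_def)
  have writes: "(r, u, b) \<in> W \<longleftrightarrow> (r = p \<and> u \<in> U \<and> b = ?st p u) \<or>
      (\<exists>r'. r = Suc r' \<and> r' \<in> relays p q M U \<and> u = v r' \<and> b = ?st r u)" for r u b
    by (auto simp: W_def)
  have marks: "p \<le> t \<and> t < q" if "t \<in> M" for t
    using that window fam(2) arc_lt by (fastforce simp: M_def)
  \<comment> \<open>The last flip of \<open>u\<close> in the window before \<open>t\<close>, if
    there is one, is a relay, and its write is the latest for \<open>u\<close> dated at most
    \<open>t\<close>; otherwise the initial write is current.\<close>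
  have decoded: "decoded_state W t u = ?st t u" if t: "t \<in> M" and u: "u \<in> U" "interacting fs (v t) u" for t u
  proof (cases "\<exists>r. p \<le> r \<and> r < t \<and> v r = u")
    case True
    define r where "r = (GREATEST r. r < t \<and> v r = u)"
    have r: "r < t \<and> v r = u" unfolding r_def by (rule GreatestI_ex_nat[of _ t]) (use True in auto)
    have le: "r' \<le> r" if "r' < t" "v r' = u" for r'
      unfolding r_def by (rule Greatest_le_nat[of _ _ t]) (use that in auto)
    have "p \<le> r" using True le by force
    have rel: "r \<in> relays p q M U"
      unfolding relays_def using r \<open>p \<le> r\<close> marks[OF t] u adj_sym le t by (fastforce simp: not_le)
    have "decoded_state W t u = ?st (Suc r) u"
    proof (rule decoded_state_eq)
      show "Suc r \<le> t" using r by simp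
      show "(Suc r, u, ?st (Suc r) u) \<in> W" using rel r unfolding writes by blast
      show "(Suc r, u, \<not> ?st (Suc r) u) \<notin> W" using \<open>p \<le> r\<close> unfolding writes by auto
      show "r' \<le> Suc r" if "r' \<le> t" "(r', u, b') \<in> W" for r' b'
        using that(2) unfolding writes
      proof
        assume "r' = p \<and> u \<in> U \<and> b' = ?st p u"
        then show ?thesis using \<open>p \<le> r\<close> by simp
      next
        assume "\<exists>r''. r' = Suc r'' \<and> r'' \<in> relays p q M U \<and> u = v r'' \<and> b' = ?st r' u"
        then show ?thesis using le that(1) by auto
      qed
    qed
    also have "\<dots> = ?st t u" by (rule states_eqI) (use r le in \<open>auto simp: Suc_le_eq dest: leD\<close>)
    finally show ?thesis .
  next
    case False
    have "decoded_state W t u = ?st p u"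
    proof (rule decoded_state_eq)
      show "p \<le> t" using marks[OF t] by simp
      show "(p, u, ?st p u) \<in> W" using u unfolding writes by simp
      show "(p, u, \<not> ?st p u) \<notin> W" unfolding writes by (auto simp: relays_def)
      show "r' \<le> p" if "r' \<le> t" "(r', u, b') \<in> W" for r' b'
        using that False unfolding writes by (auto simp: relays_def Suc_le_eq)
    qed
    also have "\<dots> = ?st t u" by (rule states_eqI) (use marks[OF t] False in auto)
    finally show ?thesis .
  qed
  have undecoded: "decoded_state W t u = False" if "u \<notin> U" for t u
    using that by (auto simp: decoded_state_def writes relays_def)
  have coeff: "row_coeff fs W (code (t, t')) i = pair_coeff fs (v t) (?st t (v t)) (?st t) (?st t') i"
    if x: "(t, t') \<in> fam" and i: "i < length fs" for t t' i
    unfolding code_def row_coeff_def prod.case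
  proof (rule pair_coeff_cong[OF i])
    fix u assume adj: "interacting fs (v t) u"
    have "t \<in> M" "t' \<in> M" using x by (force simp: M_def)+
    have arc: "(t, t') \<in> arcs" using x fam(2) by blast
    show "of_bool (decoded_state W t u) - of_bool (decoded_state W t' u) = (of_bool (?st t u) - of_bool (?st t' u) :: real)"
    proof (cases "u \<in> U")
      case True
      then show ?thesis using decoded \<open>t \<in> M\<close> \<open>t' \<in> M\<close> adj arc_lt(4)[OF arc] by simp
    next
      case False
      \<comment> \<open>A variable outside \<open>U\<close> is not flipped inside the arc and is
        decoded as \<open>False\<close> at both ends, so both differences vanish.\<close>
      have "v r \<noteq> u" if "t \<le> r" "r < t'" for r
      proof (cases "r = t")
        case True then show ?thesis using adj by (auto simp: interacting_def)
      next
        case ne: False then show ?thesis using affected[OF x, of r] that adj False by auto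
      qed
      then have "?st t u = ?st t' u" using arc_lt(1)[OF arc] by (intro states_eqI) auto
      then show ?thesis using undecoded[OF False] by simp
    qed
  qed
  obtain f where f: "\<And>x. x \<in> fam \<Longrightarrow> interacting fs (v (fst x)) (f x) \<and> changed (fst x) (snd x) (f x)"
    "\<And>x y. x \<in> fam \<Longrightarrow> y \<in> fam \<Longrightarrow> y \<noteq> x \<Longrightarrow>
        \<not> (v (fst y) = v (fst x) \<and> changed (fst y) (snd y) (f x)) \<and>
        \<not> (v (fst y) = f x \<and> changed (fst y) (snd y) (v (fst x)))"
    using sep unfolding separated_def by metis
  have "\<exists>i<length fs. fst (fs ! i) \<in> {(v (fst x), f x), (f x, v (fst x))} \<and> \<bar>row_coeff fs W (code x) i\<bar> \<ge> 1"
    if x: "x \<in> fam" for x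
  proof -
    obtain t t' where tt: "x = (t, t')" by (metis surj_pair)
    have "(t, t') \<in> arcs" using x fam(2) tt by blast
    moreover have "f x \<noteq> v t" using f(1)[OF x] tt by (auto simp: interacting_def)
    ultimately have "?st t (f x) \<noteq> ?st t' (f x)"
      using f(1)[OF x] changed_iff_states[of t t' "f x" \<tau>] arc_lt tt by auto
    then obtain i where "i < length fs" "fst (fs ! i) \<in> {(v t, f x), (f x, v t)}"
      "\<bar>pair_coeff fs (v t) (?st t (v t)) (?st t) (?st t') i\<bar> \<ge> 1"
      using pair_coeff_ge_1[of fs "v t" "f x" "?st t" "?st t'" "?st t (v t)"] f(1)[OF x] tt by auto
    then show ?thesis using coeff[of t t' i] x tt by auto
  qed
  then obtain g where g: "\<And>x. x \<in> fam \<Longrightarrow> g x < length fs \<and>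
      fst (fs ! g x) \<in> {(v (fst x), f x), (f x, v (fst x))} \<and> \<bar>row_coeff fs W (code x) (g x)\<bar> \<ge> 1"
    by metis
  have others_zero: "row_coeff fs W (code y) (g x) = 0" if x: "x \<in> fam" and y: "y \<in> fam" "y \<noteq> x" for x y
  proof (rule ccontr)
    assume ne: "row_coeff fs W (code y) (g x) \<noteq> 0"
    obtain t t' where tt: "y = (t, t')" by (metis surj_pair)
    have arc: "(t, t') \<in> arcs" using y fam(2) tt by blast
    have gx: "g x < length fs" "fst (fs ! g x) \<in> {(v (fst x), f x), (f x, v (fst x))}" using g[OF x] by auto
    have "pair_coeff fs (v t) (?st t (v t)) (?st t) (?st t') (g x) \<noteq> 0"
      using ne coeff[of t t' "g x"] y gx(1) tt by simp
    then obtain u where u: "interacting fs (v t) u" "?st t u \<noteq> ?st t' u" "fst (fs ! g x) \<in> {(v t, u), (u, v t)}"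
      using pair_coeff_nonzeroD gx(1) by blast
    have "u \<noteq> v t" using u(1) by (auto simp: interacting_def)
    then have "changed t t' u" using u(2) changed_iff_states[of t t' u \<tau>] arc_lt[OF arc] by simp
    moreover have "(v t = v (fst x) \<and> u = f x) \<or> (v t = f x \<and> u = v (fst x))"
      using u(3) gx(2) by auto
    ultimately show False using f(2)[OF x y] tt by auto
  qed
  have inj: "inj_on code fam" by (auto simp: inj_on_def code_def)
  have "private_rows fs (code ` fam) W"
    unfolding private_rows_def
  proof (intro exI[of _ "\<lambda>c. g (inv_into fam code c)"] ballI)
    fix c assume "c \<in> code ` fam"
    then obtain x where x: "x \<in> fam" "c = code x" by blast
    have "inv_into fam code c = x" using x inj by simp
    moreover have "row_coeff fs W y (g x) = 0" if y: "y \<in> code ` fam" "y \<noteq> c" for y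
    proof -
      obtain z where "z \<in> fam" "y = code z" using y(1) by blast
      then show ?thesis using others_zero[OF x(1), of z] y(2) x(2) by blast
    qed
    ultimately show "g (inv_into fam code c) < length fs \<and> \<bar>row_coeff fs W c (g (inv_into fam code c))\<bar> \<ge> 1 \<and>
        (\<forall>y\<in>code ` fam. y \<noteq> c \<longrightarrow> row_coeff fs W y (g (inv_into fam code c)) = 0)"
      using g[OF x(1)] x(2) by simp
  qed
  moreover have "card W \<le> 400 * s * card (code ` fam)"
  proof -
    have "card W \<le> card U + card (relays p q M U)"
      unfolding W_def by (meson add_mono card_Un_le card_image_le finU finrel le_trans)
    then show ?thesis using cost card_image[OF inj] by (simp add: M_def)
  qed
  moreover have "W \<subseteq> {..2 * n} \<times> {..<n} \<times> UNIV"
  proof -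
    obtain t t' where "(t, t') \<in> fam" using fam(1) by auto
    then have "p \<le> 2 * n" using window[of t t'] arc_lt(3)[of t t'] fam(2) by auto
    moreover have "u < n" if "u \<in> U" for u using U that vars q by force
    moreover have "Suc r \<le> 2 * n \<and> v r < n" if "r \<in> relays p q M U" for r
      using that q vars by (auto simp: relays_def)
    ultimately show ?thesis by (auto simp: W_def)
  qed
  moreover have "code ` fam \<subseteq> {..<2 * n} \<times> {..<2 * n} \<times> {..<n} \<times> UNIV"
    using fam(2) arc_lt vars by (fastforce simp: code_def)
  ultimately have "(code ` fam, W) \<in> codes fs n (400 * s)" using fam(1) by (simp add: codes_def)
  moreover have "0 < (\<Sum>i<length fs. row_coeff fs W x i * w i) \<and> (\<Sum>i<length fs. row_coeff fs W x i * w i) \<le> 2 * \<epsilon>"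
    if "x \<in> code ` fam" for x
  proof -
    obtain t t' where x: "(t, t') \<in> fam" "x = code (t, t')" using \<open>x \<in> code ` fam\<close> by auto
    then have arc: "(t, t') \<in> arcs" using fam(2) by blast
    have "(\<Sum>i<length fs. row_coeff fs W x i * w i) = gain (bfop_objective fs w) \<tau> v t + gain (bfop_objective fs w) \<tau> v t'"
      using coeff[OF x(1)] x(2) two[OF arc] by simp
    then show ?thesis using gain[of t] gain[of t'] arc_lt[OF arc] by simp
  qed
  ultimately show ?thesis using that by blast
qed

subsection \<open>Termination of FLIP\<close>

lemma all_flip_terminate_within_cong:
  assumes "improving_vars n obj = improving_vars n obj'"
  shows "all_flip_terminate_within n obj B = all_flip_terminate_within n obj' B"
proof -
  have "flip_run n obj \<rho> \<tau> s = flip_run n obj' \<rho> \<tau> s" for \<rho> \<tau> s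
    by (induction s) (simp_all add: assms)
  then show ?thesis
    by (simp add: all_flip_terminate_within_def flip_terminates_within_def pivoting_rule_def assms)
qed

lemma all_flip_terminate_within_mono:
  assumes "all_flip_terminate_within n obj B" "B \<le> B'"
  shows "all_flip_terminate_within n obj B'"
  using assms unfolding all_flip_terminate_within_def flip_terminates_within_def by (meson order_trans)

text \<open>The set depends on \<open>w\<close> only through finitely many comparisons of objective values.\<close>

lemma sets_all_flip_terminate_within:
  assumes meas: "\<And>\<tau>. (\<lambda>w. obj w \<tau>) \<in> borel_measurable M"
    and local: "\<And>w \<tau> \<tau>'. (\<And>i. i < n \<Longrightarrow> \<tau> i = \<tau>' i) \<Longrightarrow> obj w \<tau> = obj w \<tau>'"
  shows "{w \<in> space M. all_flip_terminate_within n (obj w) B} \<in> sets M"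
proof -
  define T where "T = {\<tau>::assignment. \<forall>i\<ge>n. \<not> \<tau> i}"
  have "T \<subseteq> (\<lambda>S i. i \<in> S) ` Pow {..<n}"
  proof
    fix \<tau> assume "\<tau> \<in> T"
    then have "\<tau> = (\<lambda>i. i \<in> {i. \<tau> i})" "{i. \<tau> i} \<in> Pow {..<n}" by (auto simp: T_def not_le[symmetric])
    then show "\<tau> \<in> (\<lambda>S i. i \<in> S) ` Pow {..<n}" by (rule image_eqI)
  qed
  then have finT: "finite (T \<times> {..<n})" using finite_subset by blast
  define pat where "pat w = {x \<in> T \<times> {..<n}. obj w (flip (snd x) (fst x)) > obj w (fst x)}" for w
  define Q where "Q w = all_flip_terminate_within n (obj w) B" for w
  have pat: "Q w = Q w'" if "pat w = pat w'" for w w'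
    unfolding Q_def
  proof (rule all_flip_terminate_within_cong)
    have "improving_vars n (obj w) \<tau> = {v. ((\<lambda>i. i < n \<and> \<tau> i), v) \<in> pat w}" for w \<tau>
    proof -
      have "obj w \<tau> = obj w (\<lambda>i. i < n \<and> \<tau> i)" by (rule local) simp
      moreover have "obj w (flip v \<tau>) = obj w (flip v (\<lambda>i. i < n \<and> \<tau> i))" if "v < n" for v
        by (rule local) (use that in \<open>simp add: flip_def\<close>)
      ultimately show ?thesis by (auto simp: improving_vars_def pat_def T_def)
    qed
    then show "improving_vars n (obj w) = improving_vars n (obj w')" using that by auto
  qed
  define \<P> where "\<P> = {P \<in> Pow (T \<times> {..<n}). \<exists>w\<in>space M. pat w = P \<and> Q w}"
  have "{w \<in> space M. Q w} = (\<Union>P\<in>\<P>. {w \<in> space M. pat w = P})"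
  proof (intro equalityI subsetI)
    fix w assume w: "w \<in> {w \<in> space M. Q w}"
    then have "pat w \<in> \<P>" by (auto simp: \<P>_def pat_def)
    then show "w \<in> (\<Union>P\<in>\<P>. {w \<in> space M. pat w = P})" using w by blast
  next
    fix w assume "w \<in> (\<Union>P\<in>\<P>. {w \<in> space M. pat w = P})"
    then obtain w' where "w \<in> space M" "pat w = pat w'" "Q w'" by (auto simp: \<P>_def)
    then show "w \<in> {w \<in> space M. Q w}" using pat[of w w'] by simp
  qed
  also have "\<dots> \<in> sets M"
  proof (rule sets.finite_UN)
    show "finite \<P>" using finT by (auto simp: \<P>_def)
    fix P assume "P \<in> \<P>"
    then have P: "P \<subseteq> T \<times> {..<n}" by (auto simp: \<P>_def)
    have "pat w = P \<longleftrightarrow> (\<forall>x\<in>T \<times> {..<n}. (obj w (fst x) < obj w (flip (snd x) (fst x))) = (x \<in> P))" for w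
      unfolding pat_def using P by blast
    then have "{w \<in> space M. pat w = P} =
        {w \<in> space M. \<forall>x\<in>T \<times> {..<n}. (obj w (fst x) < obj w (flip (snd x) (fst x))) = (x \<in> P)}"
      by simp
    also have "\<dots> \<in> sets M"
    proof (rule sets.sets_Collect_finite_All[OF _ finT])
      fix x
      have [measurable]: "{w \<in> space M. obj w (fst x) < obj w (flip (snd x) (fst x))} \<in> sets M"
        by (rule borel_measurable_less[OF meas meas])
      show "{w \<in> space M. (obj w (fst x) < obj w (flip (snd x) (fst x))) = (x \<in> P)} \<in> sets M"
        by (cases "x \<in> P") simp_all
    qed
    finally show "{w \<in> space M. pat w = P} \<in> sets M" .
  qed
  finally show ?thesis by (simp add: Q_def)
qed

lemma flip_run_nonempty: "flip_run n obj \<rho> \<tau> s \<noteq> []"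
  by (induction s) (auto simp: Let_def)

lemma flip_run_stopped:
  assumes "improving_vars n obj (last (flip_run n obj \<rho> \<tau> s)) = {}" "s \<le> s'"
  shows "flip_run n obj \<rho> \<tau> s' = flip_run n obj \<rho> \<tau> s"
  using assms(2) by (induction s' rule: dec_induct) (simp_all add: assms(1))

text \<open>Each block of \<open>N\<close> steps raises the objective by at least
  \<open>\<epsilon>\<close>, so \<open>J\<close> blocks would exceed its range of width
  \<open>2 * C\<close>.\<close>

lemma all_flip_terminate_within_blocks:
  assumes bounded: "\<And>\<tau>. \<bar>obj \<tau>\<bar> \<le> C"
    and block: "\<And>\<tau> v. (\<And>t. t < N \<Longrightarrow> v t < n \<and> 0 < gain obj \<tau> v t) \<Longrightarrow> \<exists>t<N. \<epsilon> < gain obj \<tau> v t"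
    and J: "2 * C < real J * \<epsilon>"
  shows "all_flip_terminate_within n obj (real (N * J))"
  unfolding all_flip_terminate_within_def flip_terminates_within_def
proof (intro allI impI exI conjI)
  fix \<tau>0 \<rho> assume piv: "pivoting_rule n obj \<rho>"
  let ?run = "flip_run n obj \<rho> \<tau>0"
  define L where "L t = last (?run t)" for t
  show "improving_vars n obj (last (?run (N * J))) = {}"
  proof (rule ccontr)
    assume ne: "improving_vars n obj (last (?run (N * J))) \<noteq> {}"
    have alive: "improving_vars n obj (L t) \<noteq> {}" if "t \<le> N * J" for t
      using ne flip_run_stopped[of n obj \<rho> \<tau>0 t "N * J"] that by (auto simp: L_def)
    define v where "v t = \<rho> (?run t)" for t
    have v: "v t \<in> improving_vars n obj (L t)" if "t \<le> N * J" for t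
      using piv alive[OF that] flip_run_nonempty unfolding pivoting_rule_def v_def L_def by blast
    have step: "L (Suc t) = flip (v t) (L t)" if "t \<le> N * J" for t
      using alive[OF that] by (simp add: L_def v_def Let_def)
    have st: "states (L a) (\<lambda>i. v (a + i)) t = L (a + t)" if "a + t \<le> N * J" for a t
      using that by (induction t) (auto simp: step)
    have up: "obj (L a) \<le> obj (L (a + t))" if "a + t \<le> N * J" for a t
      using that
    proof (induction t)
      case (Suc t)
      then have "v (a + t) \<in> improving_vars n obj (L (a + t))" by (intro v) simp
      then have "obj (L (a + t)) < obj (L (Suc (a + t)))"
        using step[of "a + t"] Suc.prems by (simp add: improving_vars_def)
      then show ?case using Suc by simp
    qed simp
    have blockgain: "obj (L a) + \<epsilon> \<le> obj (L (a + N))" if a: "a + N \<le> N * J" for a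
    proof -
      let ?v = "\<lambda>i. v (a + i)"
      have g: "gain obj (L a) ?v t = obj (L (Suc (a + t))) - obj (L (a + t))" if "t < N" for t
        unfolding gain_def using st[of a t] st[of a "Suc t"] that a by simp
      have "?v t < n \<and> 0 < gain obj (L a) ?v t" if "t < N" for t
        using v[of "a + t"] step[of "a + t"] that a g[OF that] by (simp add: improving_vars_def)
      then obtain t where t: "t < N" "\<epsilon> < gain obj (L a) ?v t" using block[where v = ?v and \<tau> = "L a"] by blast
      have "obj (L a) \<le> obj (L (a + t))" using up[of a t] t(1) a by simp
      moreover have "obj (L (Suc (a + t))) \<le> obj (L (a + N))"
        using up[of "Suc (a + t)" "N - Suc t"] t(1) a by simp
      ultimately show ?thesis using t(2) g[OF t(1)] by linarith
    qed
    have "obj (L 0) + real j * \<epsilon> \<le> obj (L (N * j))" if "j \<le> J" for j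
      using that
    proof (induction j)
      case (Suc j)
      have "N * j + N \<le> N * J" using Suc.prems by (metis add.commute mult_Suc_right mult_le_mono2)
      then have "obj (L (N * j)) + \<epsilon> \<le> obj (L (N * Suc j))"
        using blockgain[of "N * j"] by (simp add: add.commute)
      then show ?case using Suc by (simp add: algebra_simps)
    qed simp
    from this[of J] show False using bounded[of "L 0"] bounded[of "L (N * J)"] J by linarith
  qed
qed simp

lemma abs_bfop_objective_le:
  assumes "bfop_instance k n fs" "\<And>i. i < length fs \<Longrightarrow> \<bar>w i\<bar> \<le> 1"
  shows "\<bar>bfop_objective fs w \<tau>\<bar> \<le> real (length fs) * real k"
proof -
  have "\<bar>w i * real (bfop_value \<tau> (fs ! i))\<bar> \<le> real k" if "i < length fs" for i
  proof -
    obtain u v f where f: "fs ! i = ((u, v), f)" by (metis surj_pair)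
    then have "((u, v), f) \<in> set fs" using that nth_mem by metis
    then have "range f \<subseteq> {0..k}"
      using bspec[OF assms(1)[unfolded bfop_instance_def], of "((u, v), f)"] by simp
    from subsetD[OF this rangeI[of f "(\<tau> u, \<tau> v)"]] have "bfop_value \<tau> (fs ! i) \<le> k"
      by (simp add: bfop_value_def f)
    then show ?thesis
      using mult_mono[of "\<bar>w i\<bar>" 1 "real (bfop_value \<tau> (fs ! i))" "real k"] assms(2)[OF that]
      by (simp add: abs_mult)
  qed
  then have "(\<Sum>i<length fs. \<bar>w i * real (bfop_value \<tau> (fs ! i))\<bar>) \<le> (\<Sum>i<length fs. real k)"
    by (intro sum_mono) simp
  then show ?thesis unfolding bfop_objective_def by (intro order_trans[OF sum_abs]) simp
qed

lemma bfop_objective_local: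
  assumes "bfop_instance k n fs" "\<And>i. i < n \<Longrightarrow> \<tau> i = \<tau>' i"
  shows "bfop_objective fs w \<tau> = bfop_objective fs w \<tau>'"
  unfolding bfop_objective_def
proof (intro sum.cong refl)
  fix i assume i: "i \<in> {..<length fs}"
  obtain u v f where f: "fs ! i = ((u, v), f)" by (metis surj_pair)
  then have "((u, v), f) \<in> set fs" using i nth_mem by (metis lessThan_iff)
  then have "u < n" "v < n" using assms(1) by (auto simp: bfop_instance_def)
  then show "w i * real (bfop_value \<tau> (fs ! i)) = w i * real (bfop_value \<tau>' (fs ! i))"
    by (simp add: bfop_value_def f assms(2))
qed

lemma sets_bfop_terminate:
  assumes "bfop_instance k n fs" "\<And>i. i < length fs \<Longrightarrow> sets (D i) = sets borel"
  shows "{w \<in> space (Pi\<^sub>M {..<length fs} D). all_flip_terminate_within n (bfop_objective fs w) B}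
    \<in> sets (Pi\<^sub>M {..<length fs} D)"
proof (rule sets_all_flip_terminate_within)
  show "(\<lambda>w. bfop_objective fs w \<tau>) \<in> borel_measurable (Pi\<^sub>M {..<length fs} D)" for \<tau>
  proof -
    have "(\<lambda>w. w i) \<in> borel_measurable (Pi\<^sub>M {..<length fs} D)" if "i < length fs" for i
      using measurable_component_singleton[of i "{..<length fs}" D] measurable_cong_sets[OF refl assms(2)[OF that]] that
      by blast
    then show ?thesis unfolding bfop_objective_def
      by (intro borel_measurable_sum borel_measurable_times borel_measurable_const) simp
  qed
qed (rule bfop_objective_local[OF assms(1)])

section \<open>The union bound over all codes\<close>

lemma finite_codes: "finite (codes fs n K)"
proof -
  have "codes fs n K \<subseteq> Pow ({..<2 * n} \<times> {..<2 * n} \<times> {..<n} \<times> UNIV) \<times> Pow ({..2 * n} \<times> {..<n} \<times> UNIV)"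
    by (auto simp: codes_def)
  then show ?thesis by (rule finite_subset) (intro finite_cartesian_product finite_Pow_iff[THEN iffD2]; simp)
qed

text \<open>The sets \<open>W\<close> allowed for a given \<open>R\<close> turn
  \<open>x ^ card R\<close> into at most \<open>y ^ card R\<close>. Summing over nonempty
  \<open>R\<close> gives \<open>(1 + y) ^ (8 * n ^ 3) - 1\<close>, and
  \<open>exp z - 1 \<le> 2 * z\<close> for \<open>0 \<le> z \<le> 1 / 2\<close>.\<close>

lemma sum_codes_le:
  fixes x y :: real
  assumes "x \<ge> 0" "y = (4 * real n ^ 2 + 2 * real n + 1) ^ K * x" "8 * real n ^ 3 * y \<le> 1 / 2"
  shows "(\<Sum>(R, W)\<in>codes fs n K. x ^ card R) \<le> 16 * real n ^ 3 * y"
proof -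
  let ?UR = "{..<2 * n} \<times> {..<2 * n} \<times> {..<n} \<times> (UNIV :: bool set)"
  let ?UW = "{..2 * n} \<times> {..<n} \<times> (UNIV :: bool set)"
  let ?S = "SIGMA R:Pow ?UR - {{}}. {W. W \<subseteq> ?UW \<and> card W \<le> K * card R}"
  have cR: "real (card ?UR) = 8 * real n ^ 3"
    by (simp add: card_cartesian_product power3_eq_cube)
  have cW: "real (card ?UW + 1) = 4 * real n ^ 2 + 2 * real n + 1"
    by (simp add: card_cartesian_product power2_eq_square algebra_simps)
  have finR: "finite ?UR" and finW: "finite ?UW" by simp_all
  have finWs: "finite {W. W \<subseteq> ?UW \<and> card W \<le> q}" for q
    by (rule finite_subset[of _ "Pow ?UW"]) auto
  have y0: "y \<ge> 0" using assms(1,2) by simp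
  have "(\<Sum>(R, W)\<in>codes fs n K. x ^ card R) \<le> (\<Sum>(R, W)\<in>?S. x ^ card R)"
  proof (rule sum_mono2)
    show "finite ?S" by (rule finite_SigmaI) (use finR finWs in auto)
    show "codes fs n K \<subseteq> ?S" by (auto simp: codes_def)
  qed (use assms(1) in auto)
  also have "\<dots> = (\<Sum>R\<in>Pow ?UR - {{}}. \<Sum>W\<in>{W. W \<subseteq> ?UW \<and> card W \<le> K * card R}. x ^ card R)"
    by (rule sum.Sigma[symmetric]) (use finR finWs in auto)
  also have "\<dots> \<le> (\<Sum>R\<in>Pow ?UR - {{}}. y ^ card R)"
  proof (rule sum_mono)
    fix R
    have "real (card {W. W \<subseteq> ?UW \<and> card W \<le> K * card R}) \<le> real ((card ?UW + 1) ^ (K * card R))"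
      using card_bounded_subsets_le[OF finW] by (simp only: of_nat_le_iff)
    also have "\<dots> = (4 * real n ^ 2 + 2 * real n + 1) ^ (K * card R)" by (simp only: of_nat_power cW)
    finally have "real (card {W. W \<subseteq> ?UW \<and> card W \<le> K * card R}) * x ^ card R
        \<le> (4 * real n ^ 2 + 2 * real n + 1) ^ (K * card R) * x ^ card R"
      using assms(1) by (intro mult_right_mono) auto
    then show "(\<Sum>W\<in>{W. W \<subseteq> ?UW \<and> card W \<le> K * card R}. x ^ card R) \<le> y ^ card R"
      by (simp add: assms(2) power_mult_distrib power_mult)
  qed
  also have "\<dots> = (\<Sum>R\<in>Pow ?UR. y ^ card R) - 1"
    using finR by (subst sum_diff1) auto
  also have "\<dots> = (y + 1) ^ card ?UR - 1" by (simp only: sum_power_card_Pow[OF finR])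
  also have "\<dots> \<le> exp (8 * real n ^ 3 * y) - 1"
  proof -
    have "y + 1 \<le> exp y" using exp_ge_add_one_self[of y] by linarith
    then have "(y + 1) ^ card ?UR \<le> exp y ^ card ?UR" using y0 by (intro power_mono) auto
    also have "\<dots> = exp (8 * real n ^ 3 * y)" by (simp only: exp_of_nat_mult[symmetric] cR)
    finally show ?thesis by simp
  qed
  also have "\<dots> \<le> 16 * real n ^ 3 * y"
    using exp_bound_lemma[of "8 * real n ^ 3 * y"] assms(3) y0 by simp
  finally show ?thesis .
qed

text \<open>The value of \<open>\<epsilon>\<close> for which the bound of
  \<open>sum_codes_le\<close>, with \<open>x = \<phi> * (2 * \<epsilon>)\<close>, equals
  \<open>1 / n\<close>.\<close>

definition min_gain :: "real \<Rightarrow> nat \<Rightarrow> nat \<Rightarrow> real" where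
  "min_gain \<phi> n K = 1 / (32 * \<phi> * real n ^ 4 * (4 * real n ^ 2 + 2 * real n + 1) ^ K)"

lemma prob_codes_le:
  fixes fs :: "bfop_function list" and \<epsilon> :: real
  assumes D: "\<And>i. i < length fs \<Longrightarrow> bounded_density_dist \<phi> (D i)" and "n > 0" "\<phi> > 0"
  and \<epsilon>: "\<epsilon> = min_gain \<phi> n K"
  defines "M \<equiv> Pi\<^sub>M {..<length fs} D"
    and "form \<equiv> \<lambda>W x w. (\<Sum>i<length fs. row_coeff fs W x i * w i)"
  defines "B \<equiv> (\<lambda>(R, W). {w \<in> space M. \<forall>x\<in>R. 0 < form W x w \<and> form W x w \<le> 2 * \<epsilon>})"
  shows "\<And>c. c \<in> codes fs n K \<Longrightarrow> B c \<in> sets M"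
    and "prob_space M"
    and "measure M (\<Union>c\<in>codes fs n K. B c) \<le> 1 / real n"
proof -
  let ?I = "{..<length fs}"
  \<comment> \<open>\<open>emeasure_private_forms_le\<close> asks for a probability measure at every
    index; the point masses lie outside the product.\<close>
  define D' where "D' i = (if i < length fs then D i else return borel 0)" for i
  have M: "M = Pi\<^sub>M ?I D'" unfolding M_def by (rule PiM_cong) (auto simp: D'_def)
  have ps: "prob_space (D' i)" for i
    using bounded_density_distD(1)[OF D[of i]] by (simp add: D'_def prob_space_return)
  have sets: "sets (D' i) = sets borel" for i
    using bounded_density_distD(2)[OF D[of i]] by (simp add: D'_def)
  show prob: "prob_space M" unfolding M by (rule prob_space_PiM) (rule ps)
  then interpret prob_space M .
  have pos: "4 * real n ^ 2 + 2 * real n + 1 > 0" by (simp add: add_nonneg_pos)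
  have eps: "\<epsilon> > 0" unfolding \<epsilon> min_gain_def using assms(2,3) pos by simp
  have fin: "finite R" if "(R, W) \<in> codes fs n K" for R W
    by (rule finite_subset[of _ "{..<2 * n} \<times> {..<2 * n} \<times> {..<n} \<times> UNIV"]) (use that in \<open>auto simp: codes_def\<close>)
  show B: "B c \<in> sets M" if c: "c \<in> codes fs n K" for c
  proof -
    obtain R W where RW: "c = (R, W)" by (metis surj_pair)
    have [measurable]: "form W x \<in> borel_measurable M" for x
      unfolding form_def M
      by (intro borel_measurable_sum borel_measurable_times borel_measurable_const measurable_component_borel sets)
    have "{w \<in> space M. \<forall>x\<in>R. 0 < form W x w \<and> form W x w \<le> 2 * \<epsilon>} \<in> sets M"
    proof (rule sets.sets_Collect_finite_All)
      show "{w \<in> space M. 0 < form W x w \<and> form W x w \<le> 2 * \<epsilon>} \<in> sets M" for x by measurable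
      show "finite R" using fin c RW by blast
    qed
    then show ?thesis by (simp add: B_def RW)
  qed
  have le: "measure M (B c) \<le> (case c of (R, W) \<Rightarrow> (\<phi> * (2 * \<epsilon>)) ^ card R)" if c: "c \<in> codes fs n K" for c
  proof -
    obtain R W where RW: "c = (R, W)" by (metis surj_pair)
    have "private_rows fs R W" using c RW by (simp add: codes_def)
    then obtain \<pi> where \<pi>: "\<forall>x\<in>R. \<pi> x < length fs \<and> \<bar>row_coeff fs W x (\<pi> x)\<bar> \<ge> 1 \<and>
        (\<forall>y\<in>R. y \<noteq> x \<longrightarrow> row_coeff fs W y (\<pi> x) = 0)" unfolding private_rows_def by blast
    have "emeasure M (B c) \<le> ennreal (\<phi> * (2 * \<epsilon>)) ^ card R"
      unfolding RW B_def M form_def prod.case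
    proof (rule emeasure_private_forms_le[where \<pi> = \<pi>])
      show "emeasure (D' i) {l..l + 2 * \<epsilon>} \<le> ennreal (\<phi> * (2 * \<epsilon>))" if "i \<in> ?I" for i l
        using bounded_density_dist_interval[OF D[of i], of "2 * \<epsilon>" l] that eps by (simp add: D'_def)
    qed (use \<pi> eps fin c RW ps sets in auto)
    also have "\<dots> = ennreal ((\<phi> * (2 * \<epsilon>)) ^ card R)" using assms(3) eps by (simp add: ennreal_power)
    finally show ?thesis using assms(3) eps by (simp add: RW emeasure_eq_measure)
  qed
  have "measure M (\<Union>c\<in>codes fs n K. B c) \<le> (\<Sum>c\<in>codes fs n K. measure M (B c))"
    using B by (intro finite_measure_subadditive_finite finite_codes) auto
  also have "\<dots> \<le> (\<Sum>(R, W)\<in>codes fs n K. (\<phi> * (2 * \<epsilon>)) ^ card R)"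
    by (rule sum_mono) (rule le)
  also have "\<dots> \<le> 16 * real n ^ 3 * ((4 * real n ^ 2 + 2 * real n + 1) ^ K * (\<phi> * (2 * \<epsilon>)))"
  proof (rule sum_codes_le[OF _ refl])
    have "8 * real n ^ 3 * ((4 * real n ^ 2 + 2 * real n + 1) ^ K * (\<phi> * (2 * \<epsilon>))) = 1 / (2 * real n)"
      unfolding \<epsilon> min_gain_def using assms(2,3) pos by (simp add: field_simps power3_eq_cube power4_eq_xxxx)
    also have "\<dots> \<le> 1 / 2" using assms(2) by (simp add: field_simps)
    finally show "8 * real n ^ 3 * ((4 * real n ^ 2 + 2 * real n + 1) ^ K * (\<phi> * (2 * \<epsilon>))) \<le> 1 / 2" .
  qed (use assms(3) eps in simp)
  also have "\<dots> = 1 / real n"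
    unfolding \<epsilon> min_gain_def using assms(2,3) pos by (simp add: field_simps power3_eq_cube power4_eq_xxxx)
  finally show "measure M (\<Union>c\<in>codes fs n K. B c) \<le> 1 / real n" .
qed

lemma bfop_terminates_whp:
  fixes fs :: "bfop_function list"
  assumes inst: "bfop_instance k n fs" and D: "\<And>i. i < length fs \<Longrightarrow> bounded_density_dist \<phi> (D i)"
    and n: "n > 0" and s: "s > 0" "2 * n \<le> 2 ^ (s * s)" and "\<phi> > 0"
    and J: "2 * (real (length fs) * real k) < real J * min_gain \<phi> n (400 * s)"
  shows "measure (Pi\<^sub>M {..<length fs} D)
      {w \<in> space (Pi\<^sub>M {..<length fs} D). all_flip_terminate_within n (bfop_objective fs w) (real (2 * n * J))}
    \<ge> 1 - 1 / real n"
proof -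
  let ?M = "Pi\<^sub>M {..<length fs} D" and ?K = "400 * s"
  let ?\<epsilon> = "min_gain \<phi> n ?K"
  let ?form = "\<lambda>W x w. (\<Sum>i<length fs. row_coeff fs W x i * w i)"
  define B where "B = (\<lambda>(R, W). {w \<in> space ?M. \<forall>x\<in>R. 0 < ?form W x w \<and> ?form W x w \<le> 2 * ?\<epsilon>})"
  define Bad where "Bad = (\<Union>c\<in>codes fs n ?K. B c)"
  let ?T = "{w \<in> space ?M. all_flip_terminate_within n (bfop_objective fs w) (real (2 * n * J))}"
  note codes = prob_codes_le[where K = ?K and fs = fs and D = D, OF D n \<open>\<phi> > 0\<close> refl, folded B_def]
  interpret prob_space ?M by (rule codes(2))
  have Bad: "Bad \<in> sets ?M" unfolding Bad_def using codes(1) finite_codes by (intro sets.finite_UN) auto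
  have T: "?T \<in> sets ?M"
    by (rule sets_bfop_terminate[OF inst bounded_density_distD(2)[OF D]])
  \<comment> \<open>The weights are bounded by 1 only almost surely, so the two events are compared
    up to a null set.\<close>
  have "AE w in ?M. \<forall>i\<in>{..<length fs}. w i \<in> {-1..1}"
  proof (rule AE_finite_allI)
    fix i assume i: "i \<in> {..<length fs}"
    show "AE w in ?M. w i \<in> {-1..1}"
    proof (rule AE_PiM_component)
      show "prob_space (D j)" if "j \<in> {..<length fs}" for j using bounded_density_distD(1)[OF D] that by simp
      show "AE x in D i. x \<in> {-1..1}" using bounded_density_distD(3)[OF D] i by blast
    qed (rule i)
  qed simp
  then have "AE w in ?M. w \<in> space ?M - Bad \<longrightarrow> w \<in> ?T"
  proof (rule AE_mp, intro AE_I2 impI)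
    fix w assume sp: "w \<in> space ?M" and w: "\<forall>i\<in>{..<length fs}. w i \<in> {-1..1}" and good: "w \<in> space ?M - Bad"
    have "all_flip_terminate_within n (bfop_objective fs w) (real (2 * n * J))"
    proof (rule all_flip_terminate_within_blocks[OF _ _ J])
      show "\<bar>bfop_objective fs w \<tau>\<bar> \<le> real (length fs) * real k" for \<tau>
        by (rule abs_bfop_objective_le[OF inst]) (use w in \<open>auto simp: abs_le_iff\<close>)
      fix \<tau> v assume run: "\<And>t. t < 2 * n \<Longrightarrow> v t < n \<and> 0 < gain (bfop_objective fs w) \<tau> v t"
      show "\<exists>t<2 * n. ?\<epsilon> < gain (bfop_objective fs w) \<tau> v t"
      proof (rule ccontr)
        assume slow: "\<not> ?thesis"
        have small: "0 < gain (bfop_objective fs w) \<tau> v t \<and> gain (bfop_objective fs w) \<tau> v t \<le> ?\<epsilon>"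
          if "t < 2 * n" for t using run[OF that] that slow by (meson not_less)
        obtain R W where RW: "(R, W) \<in> codes fs n ?K"
          "\<And>x. x \<in> R \<Longrightarrow> 0 < ?form W x w \<and> ?form W x w \<le> 2 * ?\<epsilon>"
          by (rule improving_run_has_code[OF n s, where v = v and w = w and \<tau> = \<tau> and \<epsilon> = ?\<epsilon> and fs = fs])
             (use run small in auto)
        then have "w \<in> B (R, W)" using sp by (simp add: B_def)
        then show False using RW(1) good by (auto simp: Bad_def)
      qed
    qed
    then show "w \<in> ?T" using sp by simp
  qed
  then have "prob (space ?M - Bad) \<le> prob ?T" by (rule finite_measure_mono_AE[OF _ T])
  moreover have "prob (space ?M - Bad) = 1 - prob Bad" by (rule prob_compl[OF Bad])
  moreover have "prob Bad \<le> 1 / real n" unfolding Bad_def by (rule codes(3))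
  ultimately show ?thesis by linarith
qed

section \<open>Choice of the scale and of the exponent\<close>

definition scale :: "nat \<Rightarrow> nat" where
  "scale n = nat \<lceil>sqrt (log 2 (2 * real n))\<rceil>"

lemma scale:
  assumes "n > 0"
  shows "scale n > 0" "2 * n \<le> 2 ^ (scale n * scale n)"
    and "real (scale n) \<le> sqrt (log 2 (2 * real n)) + 1"
proof -
  have l: "log 2 (2 * real n) \<ge> 1" using assms by (simp add: log_mult)
  then have sq: "sqrt (log 2 (2 * real n)) \<ge> 1" by simp
  then show pos: "scale n > 0" by (simp add: scale_def)
  have ge: "sqrt (log 2 (2 * real n)) \<le> real (scale n)" unfolding scale_def by (rule real_nat_ceiling_ge)
  show "real (scale n) \<le> sqrt (log 2 (2 * real n)) + 1" using sq unfolding scale_def by linarith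
  have "log 2 (2 * real n) = sqrt (log 2 (2 * real n)) ^ 2" using l by simp
  also have "\<dots> \<le> real (scale n) ^ 2" using ge sq by (intro power_mono) auto
  finally have "log 2 (2 * real n) \<le> real (scale n * scale n)" by (simp add: power2_eq_square)
  then have "2 * real n \<le> 2 powr real (scale n * scale n)" using assms by (simp add: log_le_iff)
  also have "\<dots> = real (2 ^ (scale n * scale n))" by (subst powr_realpow) simp_all
  finally have "real (2 * n) \<le> real (2 ^ (scale n * scale n))" by simp
  then show "2 * n \<le> 2 ^ (scale n * scale n)" by (simp only: of_nat_le_iff)
qed

text \<open>For \<open>n \<ge> 2\<close> the base \<open>4 * n ^ 2 + 2 * n + 1\<close> is at most
  \<open>n ^ 5\<close>, and its power \<open>400 * scale n\<close> gives the 2000. Of the rest, 5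
  comes from \<open>n ^ 4\<close> in \<open>min_gain\<close> and the block length
  \<open>2 * n\<close>, and \<open>128 * k + 4\<close> from bounding that constant factor by a power
  of \<open>n\<close>.\<close>

definition flip_exponent :: "nat \<Rightarrow> nat \<Rightarrow> real" where
  "flip_exponent k n = real (9 + 128 * k + 2000 * scale n)"

lemma flip_exponent_bigo: "flip_exponent k \<in> O(\<lambda>n. sqrt (ln (real n)))"
proof -
  have "flip_exponent k \<in> O(\<lambda>n. real (9 + 128 * k) + 2000 * (sqrt (ln (2 * real n) / ln 2) + 1))"
  proof (rule landau_o.big_mono)
    show "\<forall>\<^sub>F n in sequentially. norm (flip_exponent k n) \<le> norm (real (9 + 128 * k) + 2000 * (sqrt (ln (2 * real n) / ln 2) + 1))"
      using eventually_gt_at_top[of 0]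
    proof eventually_elim
      case (elim n)
      have "0 \<le> ln (2 * real n)" using elim by simp
      then show ?case using scale(3)[OF elim] by (simp add: flip_exponent_def log_def)
    qed
  qed
  also have "(\<lambda>n. real (9 + 128 * k) + 2000 * (sqrt (ln (2 * real n) / ln 2) + 1)) \<in> O(\<lambda>n. sqrt (ln (real n)))"
    by real_asymp
  finally show ?thesis .
qed

lemma step_bound:
  assumes "n \<ge> 2" "\<phi> \<ge> 1 / 2" "m > 0"
  obtains J :: nat where "2 * (real m * real k) < real J * min_gain \<phi> n (400 * scale n)"
    "real (2 * n * J) \<le> \<phi> * real m * real n powr flip_exponent k n"
proof -
  let ?K = "400 * scale n" and ?n = "real n"
  let ?\<epsilon> = "min_gain \<phi> n ?K"
  define p where "p = 4 * ?n ^ 2 + 2 * ?n + 1"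
  have pos: "p > 0" unfolding p_def by (simp add: add_nonneg_pos)
  have eps: "?\<epsilon> > 0" unfolding min_gain_def using assms pos by (simp add: p_def)
  define J where "J = nat \<lfloor>2 * (real m * real k) / ?\<epsilon>\<rfloor> + 1"
  have "2 * (real m * real k) / ?\<epsilon> < real J" unfolding J_def by linarith
  then have J1: "2 * (real m * real k) < real J * ?\<epsilon>" using eps by (simp add: field_simps)
  have "2 * (real m * real k) / ?\<epsilon> \<ge> 0" using eps by simp
  then have "real J \<le> 2 * (real m * real k) / ?\<epsilon> + 1" unfolding J_def by linarith
  also have "2 * (real m * real k) / ?\<epsilon> = 2 * (real m * real k) * (32 * \<phi> * ?n ^ 4 * p ^ ?K)"
    by (simp add: min_gain_def p_def)
  also have "\<dots> + 1 \<le> (64 * real k + 2) * (\<phi> * real m) * (?n ^ 4 * ?n ^ (5 * ?K))"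
  proof -
    have n2: "?n \<ge> 2" using assms by simp
    have "p \<le> ?n ^ 5"
    proof -
      have "4 * ?n ^ 2 \<le> 2 * ?n ^ 3" using n2 by (simp add: power2_eq_square power3_eq_cube)
      moreover have "2 * ?n + 1 \<le> 2 * ?n ^ 3"
      proof -
        have "4 * ?n \<le> ?n ^ 3" using mult_mono[of 2 ?n 2 ?n] n2 by (simp add: power3_eq_cube)
        then show ?thesis using n2 by linarith
      qed
      moreover have "4 * ?n ^ 3 \<le> ?n ^ 2 * ?n ^ 3"
        using n2 power_mono[of 2 ?n 2] by (intro mult_right_mono) auto
      ultimately show ?thesis unfolding p_def by (simp flip: power_add)
    qed
    then have "p ^ ?K \<le> (?n ^ 5) ^ ?K" using pos by (intro power_mono) auto
    then have pK: "p ^ ?K \<le> ?n ^ (5 * ?K)" by (simp add: power_mult)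
    have "2 * (real m * real k) * (32 * \<phi> * ?n ^ 4 * p ^ ?K) = 64 * real k * (\<phi> * real m) * (?n ^ 4 * p ^ ?K)"
      by simp
    also have "\<dots> \<le> 64 * real k * (\<phi> * real m) * (?n ^ 4 * ?n ^ (5 * ?K))"
      using pK assms by (intro mult_left_mono) auto
    finally have 1: "2 * (real m * real k) * (32 * \<phi> * ?n ^ 4 * p ^ ?K) \<le> 64 * real k * (\<phi> * real m) * (?n ^ 4 * ?n ^ (5 * ?K))" .
    \<comment> \<open>This absorbs the 1 added when \<open>J\<close> is rounded.\<close>
    have "1 / 2 * 1 \<le> \<phi> * real m" using assms by (intro mult_mono) auto
    moreover have "1 \<le> ?n ^ 4 * ?n ^ (5 * ?K)"
      using n2 mult_mono[of 1 "?n ^ 4" 1 "?n ^ (5 * ?K)"] by (simp add: one_le_power)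
    ultimately have "1 * 1 \<le> 2 * (\<phi> * real m) * (?n ^ 4 * ?n ^ (5 * ?K))"
      by (intro mult_mono) auto
    then show ?thesis using 1 by (simp only: distrib_right)
  qed
  finally have "real J \<le> (64 * real k + 2) * (\<phi> * real m) * (?n ^ 4 * ?n ^ (5 * ?K))" .
  then have "real (2 * n * J) \<le> 2 * ?n * ((64 * real k + 2) * (\<phi> * real m) * (?n ^ 4 * ?n ^ (5 * ?K)))"
    by (simp add: mult_left_mono)
  also have "\<dots> = \<phi> * real m * (real (128 * k + 4) * (?n ^ 5 * ?n ^ (5 * ?K)))"
  proof -
    have "?n ^ 5 = ?n * ?n ^ 4" by (simp add: numeral_eq_Suc)
    then show ?thesis by (simp add: algebra_simps)
  qed
  also have "\<dots> \<le> \<phi> * real m * (?n ^ (128 * k + 4) * (?n ^ 5 * ?n ^ (5 * ?K)))"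
  proof -
    have "128 * k + 4 \<le> 2 ^ (128 * k + 4)" using less_exp[of "128 * k + 4"] by simp
    also have "\<dots> \<le> n ^ (128 * k + 4)" using assms by (intro power_mono) auto
    finally have "real (128 * k + 4) \<le> real (n ^ (128 * k + 4))" by (simp only: of_nat_le_iff)
    then show ?thesis using assms by (intro mult_left_mono mult_right_mono) auto
  qed
  also have "?n ^ (128 * k + 4) * (?n ^ 5 * ?n ^ (5 * ?K)) = ?n ^ (9 + 128 * k + 2000 * scale n)"
    by (simp only: power_add[symmetric]) (rule arg_cong[where f = "\<lambda>e. ?n ^ e"], simp)
  also have "\<dots> = ?n powr flip_exponent k n"
    unfolding flip_exponent_def using assms by (subst powr_realpow) auto
  finally show ?thesis using that J1 by blast
qed

lemma bfop_smoothed: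
  fixes fs :: "bfop_function list"
  assumes inst: "bfop_instance k n fs" and D: "\<And>i. i < length fs \<Longrightarrow> bounded_density_dist \<phi> (D i)"
    and n: "n \<ge> 2"
  shows "measure (Pi\<^sub>M {..<length fs} D)
      {w \<in> space (Pi\<^sub>M {..<length fs} D). all_flip_terminate_within n (bfop_objective fs w)
        (\<phi> * real (length fs) * real n powr flip_exponent k n)} \<ge> 1 - 1 / real n"
proof (cases "fs = []")
  case True
  have "all_flip_terminate_within n (bfop_objective fs w) (\<phi> * real (length fs) * real n powr flip_exponent k n)" for w
    using True by (auto simp: all_flip_terminate_within_def flip_terminates_within_def improving_vars_def
        bfop_objective_def intro!: exI[of _ 0])
  moreover have "prob_space (Pi\<^sub>M {..<length fs} D)" using True by (intro prob_space_PiM) simp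
  ultimately show ?thesis using n by (simp add: prob_space.prob_space)
next
  case False
  then have "\<phi> \<ge> 1 / 2" using bounded_density_dist_ge_half[OF D[of 0]] by simp
  then obtain J where J: "2 * (real (length fs) * real k) < real J * min_gain \<phi> n (400 * scale n)"
    "real (2 * n * J) \<le> \<phi> * real (length fs) * real n powr flip_exponent k n"
    using step_bound[OF n, of \<phi> "length fs" k] False by auto
  have n0: "n > 0" using n by simp
  interpret prob_space "Pi\<^sub>M {..<length fs} D"
    by (rule prob_space_PiM) (use bounded_density_distD(1)[OF D] in simp)
  have "1 - 1 / real n \<le> prob {w \<in> space (Pi\<^sub>M {..<length fs} D).
      all_flip_terminate_within n (bfop_objective fs w) (real (2 * n * J))}"
    by (rule bfop_terminates_whp[OF inst D n0 scale(1,2)[OF n0] _ J(1)]) (use \<open>\<phi> \<ge> 1 / 2\<close> in auto)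
  also have "\<dots> \<le> prob {w \<in> space (Pi\<^sub>M {..<length fs} D). all_flip_terminate_within n (bfop_objective fs w)
      (\<phi> * real (length fs) * real n powr flip_exponent k n)}"
  proof (rule finite_measure_mono)
    show "{w \<in> space (Pi\<^sub>M {..<length fs} D). all_flip_terminate_within n (bfop_objective fs w) (real (2 * n * J))}
      \<subseteq> {w \<in> space (Pi\<^sub>M {..<length fs} D). all_flip_terminate_within n (bfop_objective fs w)
          (\<phi> * real (length fs) * real n powr flip_exponent k n)}"
      using all_flip_terminate_within_mono[OF _ J(2)] by blast
  qed (rule sets_bfop_terminate[OF inst bounded_density_distD(2)[OF D]])
  finally show ?thesis .
qed

text \<open>A single variable is paired with itself; the empty tuple is given the variable 0, which
  exists only for \<open>n > 0\<close>.\<close>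

definition bfop_of_constraint :: "csp_constraint \<Rightarrow> bfop_function" where
  "bfop_of_constraint = (\<lambda>(t, R). case t of
       [] \<Rightarrow> ((0, 0), \<lambda>_. of_bool ([] \<in> R))
     | [u] \<Rightarrow> ((u, u), \<lambda>(a, _). of_bool ([a] \<in> R))
     | u # v # _ \<Rightarrow> ((u, v), \<lambda>(a, b). of_bool ([a, b] \<in> R)))"

lemma bfop_instance_of_csp:
  assumes "max2csp_instance n cs" "n > 0"
  shows "bfop_instance 1 n (map bfop_of_constraint cs)"
proof -
  have "u < n \<and> v < n \<and> range f \<subseteq> {0..1}" if mem: "((u, v), f) \<in> set (map bfop_of_constraint cs)" for u v f
  proof -
    obtain t R where c: "(t, R) \<in> set cs" "((u, v), f) = bfop_of_constraint (t, R)" using mem by auto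
    then have "set t \<subseteq> {..<n}" using assms(1) by (auto simp: max2csp_instance_def)
    then show ?thesis using assms(2) c(2) by (auto simp: bfop_of_constraint_def split: list.splits)
  qed
  then show ?thesis unfolding bfop_instance_def by blast
qed

lemma csp_objective_eq_bfop:
  assumes "max2csp_instance n cs"
  shows "csp_objective cs w = bfop_objective (map bfop_of_constraint cs) w"
proof
  fix \<tau>
  have "real (bfop_value \<tau> (bfop_of_constraint c)) = of_bool (satisfies \<tau> c)" if c: "c \<in> set cs" for c
  proof -
    obtain t R where tR: "c = (t, R)" by (metis surj_pair)
    have "length t \<le> 2" using assms c tR by (auto simp: max2csp_instance_def)
    then consider "t = []" | u where "t = [u]" | u v where "t = [u, v]"
      by (metis (no_types, opaque_lifting) One_nat_def Suc_1 Suc_le_mono le_zero_eq length_0_conv length_Suc_conv list.size(4) neq_Nil_conv le_SucE)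
    then show ?thesis by cases (simp_all add: tR bfop_value_def bfop_of_constraint_def satisfies_def)
  qed
  then have "(\<Sum>i<length cs. w i * real (bfop_value \<tau> (map bfop_of_constraint cs ! i))) =
      (\<Sum>i<length cs. if satisfies \<tau> (cs ! i) then w i else 0)"
    by (intro sum.cong) auto
  also have "\<dots> = (\<Sum>i | i < length cs \<and> satisfies \<tau> (cs ! i). w i)"
    by (simp add: sum.inter_filter[symmetric])
  finally show "csp_objective cs w \<tau> = bfop_objective (map bfop_of_constraint cs) w \<tau>"
    by (simp add: csp_objective_def bfop_objective_def)
qed

theorem theorem1p2:
  "(\<exists>(g :: nat \<Rightarrow> real) (\<epsilon> :: nat \<Rightarrow> real).
      g \<in> O(\<lambda>n. sqrt (ln (real n))) \<and> \<epsilon> \<in> o(\<lambda>n. 1) \<and>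
      (\<forall>(n :: nat) (cs :: csp_constraint list) (\<phi> :: real) (D :: nat \<Rightarrow> real measure).
         max2csp_instance n cs \<longrightarrow> (\<forall>i < length cs. bounded_density_dist \<phi> (D i)) \<longrightarrow>
         measure (Pi\<^sub>M {..<length cs} D)
           {w \<in> space (Pi\<^sub>M {..<length cs} D).
              all_flip_terminate_within n (csp_objective cs w)
                (\<phi> * real (length cs) * real n powr g n)}
         \<ge> 1 - \<epsilon> n))
   \<and>
   (\<forall>k :: nat. \<exists>(g :: nat \<Rightarrow> real) (\<epsilon> :: nat \<Rightarrow> real).
      g \<in> O(\<lambda>n. sqrt (ln (real n))) \<and> \<epsilon> \<in> o(\<lambda>n. 1) \<and>
      (\<forall>(n :: nat) (fs :: bfop_function list) (\<phi> :: real) (D :: nat \<Rightarrow> real measure).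
         bfop_instance k n fs \<longrightarrow> (\<forall>i < length fs. bounded_density_dist \<phi> (D i)) \<longrightarrow>
         measure (Pi\<^sub>M {..<length fs} D)
           {w \<in> space (Pi\<^sub>M {..<length fs} D).
              all_flip_terminate_within n (bfop_objective fs w)
                (\<phi> * real (length fs) * real n powr g n)}
         \<ge> 1 - \<epsilon> n))"
proof -
  \<comment> \<open>The value 1 makes the claim trivial for \<open>n < 2\<close>, which
    \<open>bfop_smoothed\<close> leaves out.\<close>
  define err :: "nat \<Rightarrow> real" where "err n = (if n < 2 then 1 else 1 / real n)" for n
  have "(\<lambda>n::nat. 1 / real n) \<in> o(\<lambda>n. 1)" by real_asymp
  moreover have "\<forall>\<^sub>F n in sequentially. 1 / real n = err n"
    using eventually_ge_at_top[of 2] by eventually_elim (simp add: err_def)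
  ultimately have err: "err \<in> o(\<lambda>n. 1)" by (simp add: landau_o.small.in_cong)
  have bfop: "measure (Pi\<^sub>M {..<length fs} D)
      {w \<in> space (Pi\<^sub>M {..<length fs} D). all_flip_terminate_within n (bfop_objective fs w)
        (\<phi> * real (length fs) * real n powr flip_exponent k n)} \<ge> 1 - err n"
    if "n \<ge> 2 \<Longrightarrow> bfop_instance k n fs" "\<forall>i < length fs. bounded_density_dist \<phi> (D i)"
    for k n fs \<phi> and D :: "nat \<Rightarrow> real measure"
    using bfop_smoothed[of k n fs \<phi> D] that by (cases "n < 2") (simp_all add: err_def)
  have csp: "measure (Pi\<^sub>M {..<length cs} D)
      {w \<in> space (Pi\<^sub>M {..<length cs} D). all_flip_terminate_within n (csp_objective cs w)
        (\<phi> * real (length cs) * real n powr flip_exponent 1 n)} \<ge> 1 - err n"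
    if "max2csp_instance n cs" "\<forall>i < length cs. bounded_density_dist \<phi> (D i)"
    for n cs \<phi> and D :: "nat \<Rightarrow> real measure"
    using bfop[of n 1 "map bfop_of_constraint cs" \<phi> D] that bfop_instance_of_csp[OF that(1)]
    by (simp add: csp_objective_eq_bfop[OF that(1)])
  show ?thesis
    by (intro conjI allI exI impI; (rule flip_exponent_bigo | rule err
        | (rule csp, assumption, assumption) | (rule bfop, assumption, assumption)))
qed

end
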